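(* Let $G$ be a connected ribbon graph with $n$ vertices, $n\geq 2$, and let $T$ be any spanning tree of $G$. Then the partial Petrial polynomial of $G$ satisfies $${}^{\partial}\varepsilon_{G}^{\times}(z)=\sum_{X\subseteq E(T)}{}^{\partial}\varepsilon_{Aux(G_X,T)}^{\times}(z)=\sum_{X\subseteq E(T)}\ \sum_{Y\subseteq E(G)\setminus E(T)} z^{\operatorname{rank}\left(\operatorname{adj}(I(Aux(G_X,T)))+\mathbb{D}_Y\right)},$$ where $G_X$ is obtained from $G$ by applying a twist to all edge-ribbons in $X$, $\mathbb{D}_Y$ is the diagonal matrix with rows and columns indexed by $E(G)\setminus E(T)$ whose $(i,i)$ entry is $1$ if $i\in Y$ and $0$ otherwise, and ranks are taken over $\mathbb{GF}(2)$.
   Context: A (finite) ribbon graph $G$ is a surface with boundary represented as the union of two sets of closed topological discs, vertex-discs $V(G)$ and edge-ribbons $E(G)$, such that: (1) vertex-discs and edge-ribbons intersect in disjoint line segments; (2) each such segment lies on the boundary of precisely one vertex-disc and one edge-ribbon; (3) every edge-ribbon contains exactly two such segments. Loops and parallel edges are allowed. Let $F(G)$ be the set of faces (boundary components) and $c(G)$ the number of connected components. The Euler characteristic is $\chi(G)=|V(G)|-|E(G)|+|F(G)|$ and the Euler genus is $\varepsilon(G)=2c(G)-\chi(G)$. For $A\subseteq E(G)$, the partial Petrial $G^{\times|A}$ is obtained by applying a twist to each edge-ribbon in $A$: detach one end of the edge-ribbon from its incident vertex-disc, give the ribbon a (half-)twist, and reattach it. (Thus $G_X=G^{\times|X}$.)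 The partial Petrial polynomial of $G$ is ${}^{\partial}\varepsilon^{\times}_{G}(z)=\sum_{A\subseteq E(G)}z^{\varepsilon(G^{\times|A})}$. Contraction: if $e$ is an edge-ribbon joining two distinct vertex-discs $u,v$, then $G/e$ is obtained by replacing $e,u,v$ with the single new vertex-disc $e\cup u\cup v$ and keeping all other edge-ribbons and vertex-discs unchanged. For a connected ribbon graph $G$ with at least two vertices and a spanning tree $T$ of $G$, the auxiliary bouquet $Aux(G,T)$ is obtained from $G$ by contracting all edge-ribbons of $T$; its edge-ribbons are those of $E(G)\setminus E(T)$. The tree $T$ is also regarded as a spanning tree of $G_X$. A bouquet is a ribbon graph with exactly one vertex-disc. Two loops of a bouquet are interlaced if their ends alternate in the cyclic order around the vertex-disc. The intersection graph $I(B)$ of a bouquet $B$ has the loops of $B$ as vertices, two being adjacent iff they are interlaced; $\operatorname{adj}(I(B))$ is its adjacency matrix over $\mathbb{GF}(2)$ (zero diagonal). *)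

theory Defs
  imports
    "HOL-Computational_Algebra.Polynomial"
    "HOL-Library.Z2"
    "Jordan_Normal_Form.DL_Rank"
begin

text \<open>
  A ribbon graph is recorded by its incidence data. An edge-ribbon is a rectangle whose four
  corners are the endpoints of the two segments along which it meets the vertex-discs. At a
  corner exactly three boundary arcs meet, and each corner is sent to the other endpoint of
  that arc:
    \<^item> \<open>seg\<close>: the segment shared by a vertex-disc and an edge-ribbon (an end of the ribbon);
    \<^item> \<open>side\<close>: the free side of the edge-ribbon;
    \<^item> \<open>arc\<close>: the part of the boundary circle of the vertex-disc up to the next segment.
  The surface is recovered by gluing discs along these circles, so no orientation of discs or
  ribbons has to be chosen. Vertex-discs are named separately, because an isolated disc
  carries no corner.
\<close>

record ('v, 'e, 'c) ribbon =
  verts :: "'v set"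
  edges :: "'e set"
  corners :: "'c set"
  vert_of :: "'c \<Rightarrow> 'v"
  edge_of :: "'c \<Rightarrow> 'e"
  seg :: "'c \<Rightarrow> 'c"
  side :: "'c \<Rightarrow> 'c"
  arc :: "'c \<Rightarrow> 'c"

definition orbit_rel :: "'c set \<Rightarrow> ('c \<Rightarrow> 'c) \<Rightarrow> ('c \<Rightarrow> 'c) \<Rightarrow> ('c \<times> 'c) set" where
  "orbit_rel C f g = {(x, y) \<in> C \<times> C. (x, y) \<in> ({(z, f z) | z. z \<in> C} \<union> {(z, g z) | z. z \<in> C})\<^sup>*}"

text \<open>
  \<open>ribbon_corners\<close>: each edge-ribbon is one rectangle, hence has exactly two ends.
  \<open>vertex_circle\<close>: the segments on a vertex-disc lie on a single boundary circle.
\<close>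

locale ribbon_graph =
  fixes G :: "('v, 'e, 'c) ribbon"
  assumes finite_verts: "finite (verts G)"
    and finite_edges: "finite (edges G)"
    and finite_corners: "finite (corners G)"
    and vert_of_in: "c \<in> corners G \<Longrightarrow> vert_of G c \<in> verts G"
    and edge_of_image: "edge_of G ` corners G = edges G"
    and seg_involution: "c \<in> corners G \<Longrightarrow> seg G c \<in> corners G \<and> seg G c \<noteq> c \<and> seg G (seg G c) = c"
    and side_involution: "c \<in> corners G \<Longrightarrow> side G c \<in> corners G \<and> side G c \<noteq> c \<and> side G (side G c) = c"
    and arc_involution: "c \<in> corners G \<Longrightarrow> arc G c \<in> corners G \<and> arc G c \<noteq> c \<and> arc G (arc G c) = c"
    and rectangle: "c \<in> corners G \<Longrightarrow> side G c \<noteq> seg G c \<and> side G (seg G c) = seg G (side G c)"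
    and ribbon_corners: "c \<in> corners G \<Longrightarrow>
      {d \<in> corners G. edge_of G d = edge_of G c} = {c, seg G c, side G c, seg G (side G c)}"
    and vertex_circle: "c \<in> corners G \<Longrightarrow>
      {d \<in> corners G. vert_of G d = vert_of G c} = orbit_rel (corners G) (seg G) (arc G) `` {c}"

definition ends :: "('v, 'e, 'c) ribbon \<Rightarrow> 'e \<Rightarrow> 'v set" where
  "ends G e = vert_of G ` {c \<in> corners G. edge_of G c = e}"

text \<open>Connected components of the spanning ribbon subgraph with edge set \<open>A\<close>, as vertex classes.\<close>

definition comps :: "('v, 'e, 'c) ribbon \<Rightarrow> 'e set \<Rightarrow> 'v set set" where
  "comps G A = verts G // {(u, v) \<in> verts G \<times> verts G. (u, v) \<in> {(x, y). \<exists>e\<in>A. ends G e = {x, y}}\<^sup>*}"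

definition ribbon_connected :: "('v, 'e, 'c) ribbon \<Rightarrow> bool" where
  "ribbon_connected G \<longleftrightarrow> card (comps G (edges G)) = 1"

text \<open>
  A boundary component runs alternately along vertex-disc arcs and ribbon sides, or is the
  whole boundary of an isolated vertex-disc.
\<close>

definition faces :: "('v, 'e, 'c) ribbon \<Rightarrow> ('v + 'c set) set" where
  "faces G = (verts G - vert_of G ` corners G)
      <+> (corners G // orbit_rel (corners G) (side G) (arc G))"

definition euler_char :: "('v, 'e, 'c) ribbon \<Rightarrow> int" where
  "euler_char G = int (card (verts G)) - int (card (edges G)) + int (card (faces G))"

definition euler_genus :: "('v, 'e, 'c) ribbon \<Rightarrow> int" where
  "euler_genus G = 2 * int (card (comps G (edges G))) - euler_char G"

text \<open>
  Giving a ribbon a half-twist at one end makes each side arrive at the other corner of that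
  end. The result does not depend on the end chosen, since \<open>seg\<close> and \<open>side\<close> commute.
\<close>

definition twist :: "('v, 'e, 'c) ribbon \<Rightarrow> 'e set \<Rightarrow> ('v, 'e, 'c) ribbon" where
  "twist G A = G\<lparr>side := (\<lambda>c. if edge_of G c \<in> A then side G (seg G c) else side G c)\<rparr>"

text \<open>The Euler genus is nonnegative, so \<open>nat\<close> does not truncate.\<close>

definition partial_petrial_poly :: "('v, 'e, 'c) ribbon \<Rightarrow> int poly" where
  "partial_petrial_poly G = (\<Sum>A\<in>Pow (edges G). monom 1 (nat (euler_genus (twist G A))))"

text \<open>
  Contraction of an edge-ribbon \<open>e\<close> with two distinct ends \<open>u\<close>, \<open>v\<close>. The new disc, the union of
  \<open>e\<close>, \<open>u\<close> and \<open>v\<close>, inherits one of the names \<open>u\<close>, \<open>v\<close>. Where the boundary of \<open>u\<close> or \<open>v\<close> reaches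
  a corner of \<open>e\<close>, the boundary of the new disc follows the side of \<open>e\<close> and then continues on the
  other disc. As \<open>e\<close> has only two sides, at most two such detours precede the next corner of
  another ribbon (two occur if \<open>e\<close> is the only ribbon at one of the discs).
\<close>

definition detour :: "('v, 'e, 'c) ribbon \<Rightarrow> 'e \<Rightarrow> 'c \<Rightarrow> 'c" where
  "detour G e c = (if edge_of G c = e then arc G (side G c) else c)"

definition contract :: "('v, 'e, 'c) ribbon \<Rightarrow> 'e \<Rightarrow> ('v, 'e, 'c) ribbon" where
  "contract G e = (let w = (SOME w. w \<in> ends G e) in
     G\<lparr>verts := insert w (verts G - ends G e),
       edges := edges G - {e},
       corners := {c \<in> corners G. edge_of G c \<noteq> e},
       vert_of := (\<lambda>c. if vert_of G c \<in> ends G e then w else vert_of G c),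
       arc := (\<lambda>c. detour G e (detour G e (arc G c)))\<rparr>)"

text \<open>For \<open>k = 1\<close> this is a loop, for \<open>k = 2\<close> a pair of parallel edges.\<close>

definition is_cycle :: "('v, 'e, 'c) ribbon \<Rightarrow> 'v list \<Rightarrow> 'e list \<Rightarrow> bool" where
  "is_cycle G vs es \<longleftrightarrow> (let k = length es in
     k > 0 \<and> length vs = k \<and> distinct vs \<and> distinct es \<and>
     set vs \<subseteq> verts G \<and> set es \<subseteq> edges G \<and>
     (\<forall>i<k. ends G (es ! i) = {vs ! i, vs ! (Suc i mod k)}))"

definition spanning_tree :: "('v, 'e, 'c) ribbon \<Rightarrow> 'e set \<Rightarrow> bool" where
  "spanning_tree G T \<longleftrightarrow> T \<subseteq> edges G \<and> card (comps G T) = 1 \<and>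
     \<not> (\<exists>vs es. is_cycle G vs es \<and> set es \<subseteq> T)"

text \<open>The order of contraction is immaterial up to the name of the resulting vertex-disc.\<close>

definition Aux :: "('v, 'e, 'c) ribbon \<Rightarrow> 'e set \<Rightarrow> ('v, 'e, 'c) ribbon" where
  "Aux G T = fold (\<lambda>e H. contract H e) (SOME ts. distinct ts \<and> set ts = T) G"

text \<open>
  The edges met when going once around the vertex-disc of a bouquet \<open>B\<close>, starting at corner \<open>c\<close>:
  each of its \<open>2 * card (edges B)\<close> segments is crossed once by \<open>seg\<close>, and \<open>arc\<close> leads to the next.
\<close>

definition boundary_word :: "('v, 'e, 'c) ribbon \<Rightarrow> 'c \<Rightarrow> 'e list" where
  "boundary_word B c = map (\<lambda>i. edge_of B (((arc B \<circ> seg B) ^^ i) c)) [0..<2 * card (edges B)]"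

definition interlaced :: "('v, 'e, 'c) ribbon \<Rightarrow> 'e \<Rightarrow> 'e \<Rightarrow> bool" where
  "interlaced B e f \<longleftrightarrow> e \<noteq> f \<and>
     (\<exists>c\<in>corners B. filter (\<lambda>g. g = e \<or> g = f) (boundary_word B c) = [e, f, e, f])"

text \<open>
  Matrices over GF(2) with rows and columns indexed by the finite set enumerated by the
  distinct list \<open>es\<close>.
\<close>

definition adj_intersection :: "('v, 'e, 'c) ribbon \<Rightarrow> 'e list \<Rightarrow> bit mat" where
  "adj_intersection B es = mat (length es) (length es)
     (\<lambda>(i, j). if interlaced B (es ! i) (es ! j) then 1 else 0)"

definition diag_indicator :: "'e set \<Rightarrow> 'e list \<Rightarrow> bit mat" where
  "diag_indicator Y es = mat (length es) (length es) (\<lambda>(i, j). if i = j \<and> es ! i \<in> Y then 1 else 0)"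

end

theory Submission
  imports Defs
begin

text \<open>
  Write a set of edges as \<open>X \<union> Y\<close> with \<open>X\<close> inside the spanning tree and \<open>Y\<close> outside. Contracting an
  edge with two distinct ends is a homotopy of the surface: the numbers of vertices and edges both
  drop by one, and faces and components correspond. It also commutes with twists of the other edges.
  Hence the partial Petrial with respect to \<open>X \<union> Y\<close> has the Euler genus of the auxiliary bouquet of
  the graph twisted at \<open>X\<close>, with its loops in \<open>Y\<close> twisted, and summing over \<open>X\<close> and \<open>Y\<close> gives the
  first equation (\<open>euler_genus_H\<close>, \<open>Aux_properties\<close>, \<open>twist_Aux\<close>).

  The second equation is a statement about a single bouquet \<open>B\<close>: its Euler genus is the rank over
  GF(2) of \<open>M\<close>, the adjacency matrix of the intersection graph with a \<open>1\<close> on the diagonal at each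
  twisted loop (\<open>euler_genus_eq_rank\<close>). The proof counts functions on corners with values in GF(2)
  that are constant on faces; for \<open>F\<close> faces there are \<open>2 ^ F\<close> of them. Going around the boundary of
  the disc, such a function changes only when a segment is crossed, and it changes by the same amount
  \<open>X e\<close> at both ends of a loop \<open>e\<close>. So it is determined by its value at one corner and the vector
  \<open>X\<close>. Conversely every vector \<open>X\<close> gives a function on the circle, and this function is constant
  along the sides of the loop \<open>e\<close> iff the entry of \<open>M X\<close> at \<open>e\<close> vanishes (\<open>sides_match_iff\<close>): between
  the ends of \<open>e\<close> exactly the loops interlaced with \<open>e\<close> are crossed an odd number of times, and if
  \<open>e\<close> is twisted then \<open>e\<close> is crossed once more. Thus \<open>2 ^ F\<close> is twice the number of kernel vectors
  of \<open>M\<close>, and \<open>F = 1 + m - rank M\<close> for \<open>m\<close> loops. Twisting the loops in \<open>Y\<close> flips the corresponding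
  diagonal entries of \<open>M\<close>; summed over all \<open>Y\<close>, the twisted loops that \<open>B\<close> has itself no longer
  matter (\<open>partial_petrial_poly_bouquet\<close>).

  The absence of cycles in the spanning tree is used in the form that every tree edge is a bridge of
  the tree (\<open>tree_of_bridges\<close>), which is easy to carry through contractions.
\<close>

section \<open>Orbits of two involutions\<close>

text \<open>
  Orbits are handled through the sets that are unions of orbits: there are \<open>2 ^ k\<close> of these for
  \<open>k\<close> orbits, so a bijection between invariant sets transfers a count of orbits without any path
  having to be followed.
\<close>

definition invariant_sets :: "'c set \<Rightarrow> ('c \<Rightarrow> 'c) \<Rightarrow> ('c \<Rightarrow> 'c) \<Rightarrow> 'c set set" where
  "invariant_sets C f g = {S. S \<subseteq> C \<and> f ` S \<subseteq> S \<and> g ` S \<subseteq> S}"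

lemma invariant_setsI:
  assumes "S \<subseteq> C" "\<And>x. x \<in> S \<Longrightarrow> f x \<in> S" "\<And>x. x \<in> S \<Longrightarrow> g x \<in> S"
  shows "S \<in> invariant_sets C f g"
  using assms by (auto simp: invariant_sets_def)

lemma invariant_setsD:
  assumes "S \<in> invariant_sets C f g"
  shows "S \<subseteq> C" "\<And>x. x \<in> S \<Longrightarrow> f x \<in> S" "\<And>x. x \<in> S \<Longrightarrow> g x \<in> S"
  using assms by (auto simp: invariant_sets_def)

lemma orbit_rel_stays_in_invariant_set:
  assumes "S \<in> invariant_sets C f g" "(x, y) \<in> orbit_rel C f g" "x \<in> S"
  shows "y \<in> S"
proof -
  have "(x, y) \<in> ({(z, f z) | z. z \<in> C} \<union> {(z, g z) | z. z \<in> C})\<^sup>*"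
    using assms(2) by (auto simp: orbit_rel_def)
  then show ?thesis
    using assms(3) by induction (use assms(1) in \<open>auto dest: invariant_setsD\<close>)
qed

locale involution_pair =
  fixes C :: "'c set" and f g :: "'c \<Rightarrow> 'c"
  assumes finite_carrier: "finite C"
    and f_involution: "c \<in> C \<Longrightarrow> f c \<in> C \<and> f c \<noteq> c \<and> f (f c) = c"
    and g_involution: "c \<in> C \<Longrightarrow> g c \<in> C \<and> g c \<noteq> c \<and> g (g c) = c"
begin

lemma equiv_orbit_rel: "equiv C (orbit_rel C f g)"
proof (rule equivI)
  let ?R = "{(z, f z) | z. z \<in> C} \<union> {(z, g z) | z. z \<in> C}"
  show "orbit_rel C f g \<subseteq> C \<times> C" "refl_on C (orbit_rel C f g)" "trans (orbit_rel C f g)"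
    by (auto simp: orbit_rel_def refl_on_def intro!: transI intro: rtrancl_trans)
  have "sym ?R"
    using f_involution g_involution by (auto intro!: symI)
  then have "sym (?R\<^sup>*)"
    by (rule sym_rtrancl)
  then show "sym (orbit_rel C f g)"
    by (auto simp: orbit_rel_def intro!: symI dest: symD)
qed

lemma orbit_invariant: "c \<in> C \<Longrightarrow> orbit_rel C f g `` {c} \<in> invariant_sets C f g"
proof (rule invariant_setsI)
  fix x assume c: "c \<in> C" and x: "x \<in> orbit_rel C f g `` {c}"
  show "f x \<in> orbit_rel C f g `` {c}" "g x \<in> orbit_rel C f g `` {c}"
    using c x f_involution g_involution
    by (auto simp: orbit_rel_def intro: rtrancl_into_rtrancl)
qed (auto simp: orbit_rel_def)

lemma card_invariant_sets: "card (invariant_sets C f g) = 2 ^ card (C // orbit_rel C f g)"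
proof -
  let ?Q = "C // orbit_rel C f g"
  have un: "\<Union>?Q = C"
    by (rule Union_quotient[OF equiv_orbit_rel])
  have in_class: "x \<in> C \<Longrightarrow> \<exists>X\<in>?Q. x \<in> X" for x
    using un by blast
  have q_inv: "X \<in> ?Q \<Longrightarrow> X \<in> invariant_sets C f g" for X
    by (auto simp: quotient_def intro: orbit_invariant)
  have sub: "X \<subseteq> S" if "S \<in> invariant_sets C f g" "X \<in> ?Q" "x \<in> X" "x \<in> S" for S X x
  proof
    fix y assume "y \<in> X"
    then have "(x, y) \<in> orbit_rel C f g"
      using quotient_eq_iff[OF equiv_orbit_rel that(2,2,3)] by simp
    then show "y \<in> S"
      using orbit_rel_stays_in_invariant_set that by fast
  qed
  have "bij_betw Union (Pow ?Q) (invariant_sets C f g)"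
  proof (rule bij_betw_byWitness[where f' = "\<lambda>S. {X \<in> ?Q. X \<subseteq> S}"])
    show "\<forall>P\<in>Pow ?Q. {X \<in> ?Q. X \<subseteq> \<Union>P} = P"
    proof
      fix P assume P: "P \<in> Pow ?Q"
      have "X \<in> P" if X: "X \<in> ?Q" "X \<subseteq> \<Union>P" for X
      proof -
        obtain x where "x \<in> X"
          using X(1) in_quotient_imp_non_empty[OF equiv_orbit_rel] by blast
        then obtain Y where "Y \<in> P" "x \<in> Y"
          using X by blast
        then have "X = Y"
          using P X \<open>x \<in> X\<close> quotient_disj[OF equiv_orbit_rel, of X Y] by blast
        then show ?thesis
          using \<open>Y \<in> P\<close> by simp
      qed
      then show "{X \<in> ?Q. X \<subseteq> \<Union>P} = P"
        using P by blast
    qed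
    show "\<forall>S\<in>invariant_sets C f g. \<Union>{X \<in> ?Q. X \<subseteq> S} = S"
    proof
      fix S assume S: "S \<in> invariant_sets C f g"
      have "\<exists>X\<in>?Q. X \<subseteq> S \<and> x \<in> X" if "x \<in> S" for x
        using in_class[of x] sub[OF S _ _ that] that S by (meson invariant_setsD(1) subsetD)
      then show "\<Union>{X \<in> ?Q. X \<subseteq> S} = S"
        by blast
    qed
    show "Union ` Pow ?Q \<subseteq> invariant_sets C f g"
      using q_inv by (fastforce simp: invariant_sets_def)
  qed auto
  then show ?thesis
    using bij_betw_same_card card_Pow[of ?Q] finite_carrier
    by (metis equiv_orbit_rel equivE finite_quotient)
qed

end

text \<open>
  Summing \<open>1\<close> over GF(2) along the two-element orbits gives the parity.
\<close>

lemma even_card_involution: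
  assumes "\<And>x. x \<in> S \<Longrightarrow> h x \<in> S \<and> h x \<noteq> x \<and> h (h x) = x"
  shows "even (card S)"
proof -
  have "(\<Sum>x\<in>S. (1 :: bit)) = 0"
    by (rule sum_involution_eq_0[where h = h]) (use assms in auto)
  then show ?thesis
    by (cases "even (card S)") (auto elim: oddE)
qed

section \<open>Twists and incidences\<close>

lemma twist_simps [simp]:
  "verts (twist G A) = verts G" "edges (twist G A) = edges G" "corners (twist G A) = corners G"
  "vert_of (twist G A) = vert_of G" "edge_of (twist G A) = edge_of G" "seg (twist G A) = seg G"
  "arc (twist G A) = arc G"
  "side (twist G A) c = (if edge_of G c \<in> A then side G (seg G c) else side G c)"
  by (simp_all add: twist_def)

lemma ends_twist [simp]: "ends (twist G A) = ends G"
  by (simp add: ends_def fun_eq_iff)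

lemma comps_twist [simp]: "comps (twist G A) = comps G"
  by (simp add: comps_def fun_eq_iff)

context ribbon_graph
begin

lemma side_neq_seg_side: "c \<in> corners G \<Longrightarrow> side G (seg G c) \<noteq> c"
  by (metis rectangle seg_involution side_involution)

lemma edge_of_seg [simp]: "c \<in> corners G \<Longrightarrow> edge_of G (seg G c) = edge_of G c"
  using ribbon_corners[of c] seg_involution[of c] by blast

lemma edge_of_side [simp]: "c \<in> corners G \<Longrightarrow> edge_of G (side G c) = edge_of G c"
  using ribbon_corners[of c] side_involution[of c] by blast

lemma face_pair: "involution_pair (corners G) (side G) (arc G)"
  by unfold_locales (use finite_corners side_involution arc_involution in auto)

lemma circle_pair: "involution_pair (corners G) (seg G) (arc G)"
  by unfold_locales (use finite_corners seg_involution arc_involution in auto)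

lemma vert_of_seg [simp]: "c \<in> corners G \<Longrightarrow> vert_of G (seg G c) = vert_of G c"
  and vert_of_arc [simp]: "c \<in> corners G \<Longrightarrow> vert_of G (arc G c) = vert_of G c"
proof -
  assume c: "c \<in> corners G"
  have "c \<in> {d \<in> corners G. vert_of G d = vert_of G c}"
    using c by simp
  then have "c \<in> orbit_rel (corners G) (seg G) (arc G) `` {c}"
    using vertex_circle[OF c] by simp
  then have "seg G c \<in> orbit_rel (corners G) (seg G) (arc G) `` {c}"
    "arc G c \<in> orbit_rel (corners G) (seg G) (arc G) `` {c}"
    using invariant_setsD(2,3)[OF involution_pair.orbit_invariant[OF circle_pair c]] by auto
  then show "vert_of G (seg G c) = vert_of G c" "vert_of G (arc G c) = vert_of G c"
    unfolding vertex_circle[OF c, symmetric] by auto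
qed

text \<open>
  The form in which the axiom that a vertex-disc has a single boundary circle is used: a set of
  corners that is stable under moving along the circle and contains one corner of it contains
  all of it.
\<close>

lemma invariant_set_contains_circle:
  assumes "S \<in> invariant_sets (corners G) (seg G) (arc G)" "c \<in> S" "d \<in> corners G"
    and "vert_of G d = vert_of G c"
  shows "d \<in> S"
proof -
  have "c \<in> corners G"
    using assms invariant_setsD(1) by blast
  then have "(c, d) \<in> orbit_rel (corners G) (seg G) (arc G)"
    using vertex_circle[of c] assms(3,4) by blast
  then show ?thesis
    using orbit_rel_stays_in_invariant_set assms by fast
qed

lemma same_edge_cases:
  assumes "c \<in> corners G" "d \<in> corners G" "edge_of G d = edge_of G c"
  obtains "d = c" | "d = seg G c" | "d = side G c" | "d = seg G (side G c)"
  using ribbon_corners[OF assms(1)] assms by blast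

lemma ribbon_graph_twist: "ribbon_graph (twist G A)"
proof (unfold_locales, goal_cases)
  case (10 c)
  then show ?case
    using seg_involution[of c] side_involution[of c] side_neq_seg_side[of c] rectangle[of c]
      side_involution[of "seg G c"] seg_involution[of "side G c"]
    by (auto elim: same_edge_cases)
next
  case (9 c)
  then show ?case
    using seg_involution[of c] side_involution[of c] side_neq_seg_side[of c] rectangle[of c]
      side_involution[of "seg G c"] seg_involution[of "side G c"]
    by auto
next
  case (7 c)
  then show ?case
    using seg_involution[of c] side_involution[of c] side_neq_seg_side[of c] rectangle[of c]
      side_involution[of "seg G c"] seg_involution[of "side G c"]
    by auto
qed (use finite_verts finite_edges finite_corners vert_of_in edge_of_image seg_involution rectangle
    side_involution arc_involution vertex_circle seg_involution side_neq_seg_side in \<open>auto\<close>)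

end

section \<open>Connectivity and bridges\<close>

definition linked :: "('v, 'e, 'c) ribbon \<Rightarrow> 'e set \<Rightarrow> ('v \<times> 'v) set" where
  "linked G A = {(x, y). \<exists>e\<in>A. ends G e = {x, y}}"

lemma sym_linked: "sym (linked G A)"
  by (auto simp: linked_def sym_def insert_commute)

lemma linked_mono: "A \<subseteq> B \<Longrightarrow> linked G A \<subseteq> linked G B"
  by (auto simp: linked_def)

lemma linked_twist [simp]: "linked (twist G X) = linked G"
  by (simp add: linked_def fun_eq_iff)

lemma card_comps_eq_1_iff:
  "card (comps G A) = 1 \<longleftrightarrow> verts G \<noteq> {} \<and> verts G \<times> verts G \<subseteq> (linked G A)\<^sup>*"
proof -
  let ?R = "{(u, v) \<in> verts G \<times> verts G. (u, v) \<in> (linked G A)\<^sup>*}"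
  have comps: "comps G A = verts G // ?R"
    by (simp add: comps_def linked_def)
  have equiv: "equiv (verts G) ?R"
    using sym_rtrancl[OF sym_linked, of G A]
    by (intro equivI) (auto simp: refl_on_def sym_def trans_def)
  show ?thesis
  proof
    assume "card (comps G A) = 1"
    then obtain K where K: "verts G // ?R = {K}"
      unfolding comps by (auto simp: card_1_singleton_iff)
    then have "verts G = K"
      using Union_quotient[OF equiv] by simp
    moreover have "K \<times> K \<subseteq> ?R"
      using K quotient_eq_iff[OF equiv, of K K] by blast
    moreover have "K \<noteq> {}"
      using K in_quotient_imp_non_empty[OF equiv] by blast
    ultimately show "verts G \<noteq> {} \<and> verts G \<times> verts G \<subseteq> (linked G A)\<^sup>*"
      by blast
  next
    assume *: "verts G \<noteq> {} \<and> verts G \<times> verts G \<subseteq> (linked G A)\<^sup>*"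
    then have "?R = verts G \<times> verts G"
      by blast
    then have "verts G // ?R = {verts G}"
      using * by (auto simp: quotient_def)
    then show "card (comps G A) = 1"
      by (simp add: comps)
  qed
qed

text \<open>
  Extending a path by one vertex keeps it simple unless it returns to an old vertex, and then it
  can be cut off there. Vertices are kept as a function on an initial segment because both the
  truncation and the extension are then immediate.
\<close>

lemma obtain_simple_path:
  assumes "(x, y) \<in> (linked G A)\<^sup>*"
  obtains n :: nat and f where "f 0 = x" "f n = y" "inj_on f {..n}"
    "\<And>i. i < n \<Longrightarrow> (f i, f (Suc i)) \<in> linked G A"
proof -
  have "\<exists>n f. f 0 = x \<and> f (n::nat) = y \<and> inj_on f {..n} \<and> (\<forall>i<n. (f i, f (Suc i)) \<in> linked G A)"
    using assms
  proof induction
    case base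
    show ?case
      by (rule exI[of _ 0], rule exI[of _ "\<lambda>_. x"]) simp
  next
    case (step y z)
    then obtain n :: nat and f where f: "f 0 = x" "f n = y" "inj_on f {..n}"
      "\<forall>i<n. (f i, f (Suc i)) \<in> linked G A"
      by blast
    show ?case
    proof (cases "z \<in> f ` {..n}")
      case True
      then obtain j where "j \<le> n" "f j = z"
        by auto
      then show ?thesis
        using f by (intro exI[of _ j] exI[of _ f]) (auto intro: inj_on_subset)
    next
      case False
      then show ?thesis
        using f step.hyps(2)
        by (intro exI[of _ "Suc n"] exI[of _ "f(Suc n := z)"])
          (auto simp: inj_on_def atMost_Suc less_Suc_eq image_iff)
    qed
  qed
  then show thesis
    using that by blast
qed

text \<open>
  Every edge of the tree is a bridge of the tree. Unlike the absence of cycles, this survives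
  contraction by a direct argument, since a path that avoids an edge after contraction lifts to one
  that avoids it before; it also shows at once that tree edges are not loops.
\<close>

definition tree_of_bridges :: "('v, 'e, 'c) ribbon \<Rightarrow> 'e set \<Rightarrow> bool" where
  "tree_of_bridges G T \<longleftrightarrow> T \<subseteq> edges G \<and> card (comps G T) = 1 \<and>
     (\<forall>e\<in>T. \<forall>x y. ends G e = {x, y} \<longrightarrow> (x, y) \<notin> (linked G (T - {e}))\<^sup>*)"

lemma (in ribbon_graph) ends_subset: "ends G e \<subseteq> verts G"
  using vert_of_in by (auto simp: ends_def)

text \<open>
  If the ends of \<open>e\<close> were still joined in the tree without \<open>e\<close>, a simple path between them would
  close up with \<open>e\<close> to a cycle. The edges of such a path are distinct because its vertices are.
\<close>

lemma (in ribbon_graph) spanning_tree_imp_tree_of_bridges: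
  assumes "spanning_tree G T"
  shows "tree_of_bridges G T"
  unfolding tree_of_bridges_def
proof (intro conjI ballI allI impI notI)
  show "T \<subseteq> edges G" "card (comps G T) = 1"
    using assms by (auto simp: spanning_tree_def)
  fix e x y
  assume e: "e \<in> T" "ends G e = {x, y}" and path: "(x, y) \<in> (linked G (T - {e}))\<^sup>*"
  obtain n :: nat and f where f: "f 0 = x" "f n = y" "inj_on f {..n}"
    and step: "\<And>i. i < n \<Longrightarrow> (f i, f (Suc i)) \<in> linked G (T - {e})"
    by (rule obtain_simple_path[OF path]) blast
  have "\<forall>i. \<exists>e'. i < n \<longrightarrow> e' \<in> T - {e} \<and> ends G e' = {f i, f (Suc i)}"
    using step unfolding linked_def by blast
  then obtain h where h: "\<And>i. i < n \<Longrightarrow> h i \<in> T - {e} \<and> ends G (h i) = {f i, f (Suc i)}"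
    by metis
  have inj_h: "inj_on h {..<n}"
  proof (rule inj_onI)
    fix i j assume ij: "i \<in> {..<n}" "j \<in> {..<n}" "h i = h j"
    then have "{f i, f (Suc i)} = {f j, f (Suc j)}"
      using h by (metis lessThan_iff)
    then have "f ` {i, Suc i} = f ` {j, Suc j}"
      by simp
    then have "{i, Suc i} = {j, Suc j}"
      using ij inj_on_image_eq_iff[OF f(3), of "{i, Suc i}" "{j, Suc j}"] by auto
    then show "i = j"
      by (auto simp: doubleton_eq_iff)
  qed
  define vs where "vs = map f [0..<Suc n]"
  define es where "es = map h [0..<n] @ [e]"
  have len: "length vs = Suc n" "length es = Suc n"
    by (simp_all add: vs_def es_def)
  have vs_nth: "i \<le> n \<Longrightarrow> vs ! i = f i" for i
    using nth_map[of i "[0..<Suc n]" f] by (simp add: vs_def nth_append del: upt_Suc)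
  have es_nth: "i < n \<Longrightarrow> es ! i = h i" "es ! n = e" for i
    by (simp_all add: es_def nth_append)
  have T: "T \<subseteq> edges G"
    using assms by (simp add: spanning_tree_def)
  have ends_nth: "ends G (es ! i) = {vs ! i, vs ! (Suc i mod Suc n)}" if "i < Suc n" for i
    using that h[of i] e f(1,2) by (cases "i = n") (auto simp: vs_nth es_nth insert_commute)
  have "set vs \<subseteq> verts G"
  proof
    fix v assume "v \<in> set vs"
    then obtain i where "i < Suc n" "v = vs ! i"
      using len by (metis in_set_conv_nth)
    then show "v \<in> verts G"
      using ends_nth[of i] ends_subset[of "es ! i"] by auto
  qed
  moreover have "distinct vs"
    unfolding vs_def by (subst distinct_map) (use f(3) in \<open>simp add: atLeast0LessThan lessThan_Suc_atMost del: upt_Suc\<close>)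
  moreover have "distinct es"
    using inj_h h by (auto simp: es_def distinct_map atLeast0LessThan)
  moreover have set_es: "set es \<subseteq> T"
    using e h by (auto simp: es_def)
  ultimately have cycle: "is_cycle G vs es"
    unfolding is_cycle_def Let_def len using ends_nth T e by blast
  then show False
    using assms set_es cycle unfolding spanning_tree_def by blast
qed

lemma card_verts_tree_of_no_edges:
  assumes "tree_of_bridges G {}"
  shows "card (verts G) = 1"
proof -
  have "linked G {} = {}"
    by (simp add: linked_def)
  then have "verts G \<noteq> {}" and same: "u = v" if "u \<in> verts G" "v \<in> verts G" for u v
    using assms that unfolding tree_of_bridges_def card_comps_eq_1_iff by auto
  then obtain u where "u \<in> verts G"
    using assms unfolding tree_of_bridges_def card_comps_eq_1_iff by blast
  then have "verts G = {u}"
    using same by blast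
  then show ?thesis
    by simp
qed

section \<open>Contraction of an edge with distinct ends\<close>

context ribbon_graph
begin

lemma corners_of_edge:
  "c \<in> corners G \<Longrightarrow> edge_of G d = edge_of G c \<and> d \<in> corners G \<longleftrightarrow> d \<in> {c, seg G c, side G c, seg G (side G c)}"
  using ribbon_corners[of c] by blast

lemma ends_edge_of: "c \<in> corners G \<Longrightarrow> ends G (edge_of G c) = {vert_of G c, vert_of G (side G c)}"
proof -
  assume c: "c \<in> corners G"
  have "{d \<in> corners G. edge_of G d = edge_of G c} = {c, seg G c, side G c, seg G (side G c)}"
    by (rule ribbon_corners[OF c])
  then show ?thesis
    using c side_involution[OF c] by (simp add: ends_def)
qed

end

text \<open>
  The edge of the corner \<open>a\<close> joins two distinct vertex-discs. Its four corners are \<open>a\<close> and \<open>seg a\<close>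
  on the disc \<open>u\<close>, and \<open>b\<close> and \<open>seg b\<close> on the disc \<open>v\<close>. The edge is given by a corner and not by its
  name so that exchanging the two ends is again an instance, with \<open>b\<close> in place of \<open>a\<close>; facts about
  one end then hold for the other.

  The end at \<open>u\<close> is called degenerate if \<open>arc a = seg a\<close>: the edge is then the only one at \<open>u\<close>.
\<close>

locale contractible = ribbon_graph G for G :: "('v, 'e, 'c) ribbon" +
  fixes a :: 'c
  assumes a_in: "a \<in> corners G" and no_loop: "vert_of G a \<noteq> vert_of G (side G a)"
begin

abbreviation "H \<equiv> contract G (edge_of G a)"
abbreviation "b \<equiv> side G a"
abbreviation "u \<equiv> vert_of G a"
abbreviation "v \<equiv> vert_of G b"
abbreviation "D \<equiv> detour G (edge_of G a)"

lemma b_in [simp]: "b \<in> corners G"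
  using a_in side_involution by blast

lemma rectangle_simps [simp]:
  "seg G a \<in> corners G" "seg G b \<in> corners G" "arc G a \<in> corners G" "arc G b \<in> corners G"
  "arc G (seg G a) \<in> corners G" "arc G (seg G b) \<in> corners G"
  "side G b = a" "seg G (seg G a) = a" "seg G (seg G b) = b"
  "side G (seg G a) = seg G b" "side G (seg G b) = seg G a"
  "seg G a \<noteq> a" "seg G b \<noteq> b"
  "arc G (arc G a) = a" "arc G (arc G b) = b" "arc G (arc G (seg G a)) = seg G a" "arc G (arc G (seg G b)) = seg G b"
  "arc G a \<noteq> a" "arc G b \<noteq> b" "arc G (seg G a) \<noteq> seg G a" "arc G (seg G b) \<noteq> seg G b"
  using seg_involution[OF a_in] seg_involution[OF b_in] side_involution[OF a_in] side_involution[OF b_in]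
    arc_involution[OF a_in] arc_involution[OF b_in] rectangle[OF a_in] rectangle[OF b_in]
    arc_involution[of "seg G a"] arc_involution[of "seg G b"]
  by simp_all

lemma vert_simps [simp]:
  "vert_of G (arc G a) = u" "vert_of G (arc G (seg G a)) = u" "vert_of G (seg G a) = u"
  "vert_of G (arc G b) = v" "vert_of G (arc G (seg G b)) = v" "vert_of G (seg G b) = v"
  using a_in by simp_all

lemma edge_of_eq_iff: "c \<in> corners G \<Longrightarrow> edge_of G c = edge_of G a \<longleftrightarrow> c = a \<or> c = seg G a \<or> c = b \<or> c = seg G b"
  using corners_of_edge[OF a_in, of c] by blast

lemma vertex_neq [simp]:
  "vert_of G c = u \<Longrightarrow> c \<noteq> b" "vert_of G c = u \<Longrightarrow> c \<noteq> seg G b"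
  "vert_of G c = v \<Longrightarrow> c \<noteq> a" "vert_of G c = v \<Longrightarrow> c \<noteq> seg G a"
  using no_loop by auto

lemma degenerate_swap: "arc G (seg G a) = a \<longleftrightarrow> arc G a = seg G a" "arc G (seg G b) = b \<longleftrightarrow> arc G b = seg G b"
  by (metis rectangle_simps(14,16)) (metis rectangle_simps(15,17))

lemma not_edge_iff:
  "edge_of G (arc G a) = edge_of G a \<longleftrightarrow> arc G a = seg G a"
  "edge_of G (arc G (seg G a)) = edge_of G a \<longleftrightarrow> arc G a = seg G a"
  "edge_of G (arc G b) = edge_of G a \<longleftrightarrow> arc G b = seg G b"
  "edge_of G (arc G (seg G b)) = edge_of G a \<longleftrightarrow> arc G b = seg G b"
  using vertex_neq(1,2)[of "arc G a"] vertex_neq(1,2)[of "arc G (seg G a)"]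
    vertex_neq(3,4)[of "arc G b"] vertex_neq(3,4)[of "arc G (seg G b)"]
  by (simp_all add: edge_of_eq_iff degenerate_swap)

lemma other_end: "contractible G b"
  using no_loop by unfold_locales (simp_all add: eq_commute)

lemma ends_e: "ends G (edge_of G a) = {u, v}"
  using ends_edge_of[OF a_in] .

text \<open>
  The name that the contraction gives to the merged disc.
\<close>

definition "w = (SOME w. w \<in> {u, v})"

lemma w_in: "w = u \<or> w = v"
proof -
  have "w \<in> {u, v}" unfolding w_def by (rule someI[of _ u]) simp
  then show ?thesis by blast
qed

lemma contract_simps [simp]:
  "verts H = insert w (verts G - {u, v})"
  "edges H = edges G - {edge_of G a}"
  "corners H = {c \<in> corners G. edge_of G c \<noteq> edge_of G a}"
  "edge_of H = edge_of G" "seg H = seg G" "side H = side G"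
  "vert_of H c = (if vert_of G c \<in> {u, v} then w else vert_of G c)"
  by (simp_all add: contract_def Let_def ends_e w_def)

lemma arc_H: "arc H c = D (D (arc G c))"
  by (simp add: contract_def Let_def)

lemma detour_simps:
  "D a = arc G b" "D (seg G a) = arc G (seg G b)"
  "D b = arc G a" "D (seg G b) = arc G (seg G a)"
  "edge_of G c \<noteq> edge_of G a \<Longrightarrow> D c = c"
  using a_in by (simp_all add: detour_def)

text \<open>
  Where the new boundary continues from a corner of the contracted edge: along the side to the
  other disc, and back along the second side if the edge is alone on that disc.
\<close>

lemma retract_simps:
  "D (D a) = (if arc G b = seg G b then arc G (seg G a) else arc G b)"
  "D (D (seg G a)) = (if arc G b = seg G b then arc G a else arc G (seg G b))"
  "D (D b) = (if arc G a = seg G a then arc G (seg G b) else arc G a)"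
  "D (D (seg G b)) = (if arc G a = seg G a then arc G b else arc G (seg G a))"
proof -
  have *: "arc G b = seg G b \<Longrightarrow> arc G (seg G b) = b" "arc G a = seg G a \<Longrightarrow> arc G (seg G a) = a"
    by (simp_all add: degenerate_swap)
  show "D (D a) = (if arc G b = seg G b then arc G (seg G a) else arc G b)"
    "D (D (seg G a)) = (if arc G b = seg G b then arc G a else arc G (seg G b))"
    "D (D b) = (if arc G a = seg G a then arc G (seg G b) else arc G a)"
    "D (D (seg G b)) = (if arc G a = seg G a then arc G b else arc G (seg G a))"
    using * by (auto simp: detour_simps not_edge_iff)
qed

lemma retract_other [simp]: "edge_of G c \<noteq> edge_of G a \<Longrightarrow> D (D c) = c"
  by (simp add: detour_simps)

lemma outside_cases:
  assumes "c \<in> corners H"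
  obtains "arc G c \<in> corners H"
  | "c = arc G a" "arc G a \<noteq> seg G a" | "c = arc G (seg G a)" "arc G a \<noteq> seg G a"
  | "c = arc G b" "arc G b \<noteq> seg G b" | "c = arc G (seg G b)" "arc G b \<noteq> seg G b"
proof (cases "edge_of G (arc G c) = edge_of G a")
  case False
  then show ?thesis using assms that(1) arc_involution by auto
next
  case True
  have c: "arc G (arc G c) = c" "arc G c \<in> corners G"
    using assms arc_involution by auto
  have "arc G c = a \<or> arc G c = seg G a \<or> arc G c = b \<or> arc G c = seg G b"
    using True c(2) edge_of_eq_iff by blast
  then have "c = arc G a \<or> c = arc G (seg G a) \<or> c = arc G b \<or> c = arc G (seg G b)"
    using c(1) by metis
  then show ?thesis
    using assms that(2-5) not_edge_iff unfolding contract_simps by blast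
qed

lemma arc_H_at_a:
  assumes "arc G a \<noteq> seg G a"
  shows "arc H (arc G a) = (if arc G b = seg G b then arc G (seg G a) else arc G b)"
    "arc H (arc G (seg G a)) = (if arc G b = seg G b then arc G a else arc G (seg G b))"
  using assms by (simp_all add: arc_H retract_simps)

lemma arc_H_at_b:
  assumes "arc G b \<noteq> seg G b"
  shows "arc H (arc G b) = (if arc G a = seg G a then arc G (seg G b) else arc G a)"
    "arc H (arc G (seg G b)) = (if arc G a = seg G a then arc G b else arc G (seg G a))"
  using assms by (simp_all add: arc_H retract_simps)

lemma arc_inj: "c \<in> corners G \<Longrightarrow> d \<in> corners G \<Longrightarrow> arc G c = arc G d \<Longrightarrow> c = d"
  by (metis arc_involution)

lemma arc_H_involution:
  assumes "c \<in> corners H"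
  shows "arc H c \<in> corners H \<and> arc H c \<noteq> c \<and> arc H (arc H c) = c"
proof -
  have "arc G a \<noteq> arc G (seg G a)" "arc G b \<noteq> arc G (seg G b)"
    using arc_inj[of "seg G a" a] arc_inj[of "seg G b" b] a_in by auto
  moreover have "arc G a \<noteq> arc G b" "arc G a \<noteq> arc G (seg G b)" "arc G (seg G a) \<noteq> arc G b"
    "arc G (seg G a) \<noteq> arc G (seg G b)"
    using no_loop by (metis vert_simps)+
  ultimately have neq: "arc G a \<noteq> arc G (seg G a)" "arc G b \<noteq> arc G (seg G b)"
    "arc G a \<noteq> arc G b" "arc G a \<noteq> arc G (seg G b)" "arc G (seg G a) \<noteq> arc G b"
    "arc G (seg G a) \<noteq> arc G (seg G b)"
    by blast+
  note neq = neq neq[symmetric]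
  show ?thesis
    using assms
  proof (cases rule: outside_cases)
    case 1
    have c: "c \<in> corners G" "edge_of G c \<noteq> edge_of G a"
      using assms unfolding contract_simps by blast+
    have arc_c: "edge_of G (arc G c) \<noteq> edge_of G a"
      using 1 unfolding contract_simps by blast
    have "arc H c = arc G c"
      unfolding arc_H using arc_c by (rule retract_other)
    moreover have "arc H (arc G c) = c"
      unfolding arc_H using arc_involution[OF c(1)] c(2) retract_other by simp
    ultimately show ?thesis
      using 1 arc_involution[OF c(1)] by (simp only: simp_thms)
  next
    case 2
    then show ?thesis
      using neq not_edge_iff
      by (cases "arc G b = seg G b") (simp_all add: arc_H_at_a arc_H_at_b)
  next
    case 3
    then show ?thesis
      using neq not_edge_iff
      by (cases "arc G b = seg G b") (simp_all add: arc_H_at_a arc_H_at_b)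
  next
    case 4
    then show ?thesis
      using neq not_edge_iff
      by (cases "arc G a = seg G a") (simp_all add: arc_H_at_a arc_H_at_b)
  next
    case 5
    then show ?thesis
      using neq not_edge_iff
      by (cases "arc G a = seg G a") (simp_all add: arc_H_at_a arc_H_at_b)
  qed
qed


lemma arc_H_away: "arc G c \<in> corners H \<Longrightarrow> arc H c = arc G c"
  unfolding arc_H by (rule retract_other) simp

lemma in_corners_H: "c \<in> corners H \<longleftrightarrow> c \<in> corners G \<and> c \<notin> {a, seg G a, b, seg G b}"
  using edge_of_eq_iff[of c] unfolding contract_simps by blast

lemma seg_H: "c \<in> corners H \<Longrightarrow> seg G c \<in> corners H \<and> seg G c \<noteq> c \<and> seg G (seg G c) = c"
  using seg_involution[of c] by simp

lemma side_H: "c \<in> corners H \<Longrightarrow> side G c \<in> corners H \<and> side G c \<noteq> c \<and> side G (side G c) = c"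
  using side_involution[of c] by simp

lemma arc_at_u:
  assumes "c \<in> corners H" "vert_of G c = u" "c \<noteq> arc G a" "c \<noteq> arc G (seg G a)"
  shows "arc G c \<in> corners H"
  using assms(1)
proof (cases rule: outside_cases)
  case 4
  then show ?thesis using assms(2) no_loop by simp
next
  case 5
  then show ?thesis using assms(2) no_loop by simp
qed (use assms in auto)

text \<open>
  A parity argument in place of following the circle of \<open>u\<close> from one corner next to the edge to the
  other. The corners of \<open>u\<close> in \<open>S\<close> are paired by \<open>seg\<close>. They are paired by \<open>arc\<close> as well, except
  that \<open>arc a\<close> and \<open>arc (seg a)\<close> have lost their partners. So an even number of these two is in \<open>S\<close>.
\<close>

lemma both_or_none:
  assumes S: "S \<in> invariant_sets (corners H) (seg G) (arc H)" and nondeg: "arc G a \<noteq> seg G a"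
  shows "arc G a \<in> S \<longleftrightarrow> arc G (seg G a) \<in> S"
proof -
  let ?Su = "{c \<in> S. vert_of G c = u}"
  let ?P = "?Su \<inter> {arc G a, arc G (seg G a)}"
  have S_H: "S \<subseteq> corners H"
    using S by (rule invariant_setsD)
  have S_G: "c \<in> corners G" if "c \<in> S" for c
    using S_H that by auto
  have fin: "finite ?Su"
    by (rule finite_subset[OF _ finite_corners]) (use S_G in blast)
  have even_Su: "even (card ?Su)"
    by (rule even_card_involution[of _ "seg G"])
      (use S_G seg_involution invariant_setsD(2)[OF S] in auto)
  have even_diff: "even (card (?Su - {arc G a, arc G (seg G a)}))"
  proof (rule even_card_involution[of _ "arc G"])
    fix c assume c: "c \<in> ?Su - {arc G a, arc G (seg G a)}"
    then have c_H: "c \<in> corners H" and c_G: "c \<in> corners G"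
      using S_H by auto
    have "arc G c \<in> corners H"
      using c arc_at_u[OF c_H] by blast
    then have "arc G c \<in> S"
      using c invariant_setsD(3)[OF S, of c] arc_H_away[of c] by (simp only: mem_Collect_eq Diff_iff)
    moreover have "arc G c \<noteq> arc G a" "arc G c \<noteq> arc G (seg G a)"
      using c_H c_G a_in arc_inj[of c a] arc_inj[of c "seg G a"] unfolding in_corners_H by auto
    ultimately show "arc G c \<in> ?Su - {arc G a, arc G (seg G a)} \<and> arc G c \<noteq> c \<and> arc G (arc G c) = c"
      using c c_G arc_involution[of c] by auto
  qed
  have "card ?Su = card ?P + card (?Su - {arc G a, arc G (seg G a)})"
    using card_Int_Diff[OF fin, of "{arc G a, arc G (seg G a)}"] .
  then have "even (card ?P)"
    using even_Su even_diff by simp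
  moreover have "arc G a \<noteq> arc G (seg G a)"
    using arc_inj[of "seg G a" a] a_in by auto
  ultimately show ?thesis
    by (cases "arc G a \<in> S"; cases "arc G (seg G a) \<in> S") auto
qed

lemma no_corners_if_degenerate:
  assumes deg: "arc G a = seg G a" and c: "c \<in> corners H"
  shows "vert_of G c \<noteq> u"
proof
  assume "vert_of G c = u"
  moreover have "{a, seg G a} \<in> invariant_sets (corners G) (seg G) (arc G)"
    using deg degenerate_swap a_in by (intro invariant_setsI) auto
  ultimately have "c \<in> {a, seg G a}"
    using invariant_set_contains_circle[of "{a, seg G a}" a c] c by auto
  then show False
    using c unfolding in_corners_H by blast
qed

lemma contains_u_corners:
  assumes S: "S \<in> invariant_sets (corners H) (seg G) (arc H)"
    and c: "c \<in> S" "vert_of G c = u"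
  shows "arc G a \<noteq> seg G a" "arc G a \<in> S" "arc G (seg G a) \<in> S"
    "d \<in> corners H \<Longrightarrow> vert_of G d = u \<Longrightarrow> d \<in> S"
proof -
  let ?Su = "{c \<in> S. vert_of G c = u}"
  have S_H: "S \<subseteq> corners H"
    using S by (rule invariant_setsD)
  have c_G: "c \<in> corners G" and c_H: "c \<in> corners H"
    using S_H c by auto
  show nondeg: "arc G a \<noteq> seg G a"
    using no_corners_if_degenerate c_H c(2) by blast
  show at_a: "arc G a \<in> S"
  proof (rule ccontr)
    assume "arc G a \<notin> S"
    then have none: "arc G a \<notin> S" "arc G (seg G a) \<notin> S"
      using both_or_none[OF S nondeg] by auto
    \<comment> \<open>Without the two corners next to the edge nothing in \<open>S\<close> notices the contraction.\<close>
    have "?Su \<in> invariant_sets (corners G) (seg G) (arc G)"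
    proof (rule invariant_setsI)
      show "?Su \<subseteq> corners G"
        using S_H by auto
      fix x assume x: "x \<in> ?Su"
      then have x_G: "x \<in> corners G"
        using S_H by auto
      show "seg G x \<in> ?Su"
        using x x_G invariant_setsD(2)[OF S] by simp
      have "arc G x \<in> corners H"
        using x none S_H by (intro arc_at_u) auto
      then have "arc G x \<in> S"
        using x invariant_setsD(3)[OF S, of x] arc_H_away[of x] by (simp only: mem_Collect_eq)
      then show "arc G x \<in> ?Su"
        using x x_G by simp
    qed
    then have "a \<in> ?Su"
      by (rule invariant_set_contains_circle[of _ c]) (use c a_in in auto)
    then show False
      using S_H by auto
  qed
  show at_seg_a: "arc G (seg G a) \<in> S"
    using at_a both_or_none[OF S nondeg] by simp
  have inv: "?Su \<union> {a, seg G a} \<in> invariant_sets (corners G) (seg G) (arc G)"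
  proof (rule invariant_setsI)
    show "?Su \<union> {a, seg G a} \<subseteq> corners G"
      using S_H a_in by auto
    fix x assume x: "x \<in> ?Su \<union> {a, seg G a}"
    show "seg G x \<in> ?Su \<union> {a, seg G a}"
      using x S_H invariant_setsD(2)[OF S, of x] by auto
    show "arc G x \<in> ?Su \<union> {a, seg G a}"
    proof (cases "x \<in> {a, seg G a, arc G a, arc G (seg G a)}")
      case True
      then show ?thesis
        using at_a at_seg_a by auto
    next
      case False
      then have x_S: "x \<in> S" "vert_of G x = u" "x \<in> corners H"
        using x S_H by auto
      then have "arc G x \<in> corners H"
        using False by (intro arc_at_u) auto
      then have "arc G x \<in> S"
        using x_S invariant_setsD(3)[OF S, of x] arc_H_away[of x] by (simp only:)
      then show ?thesis
        using x_S by simp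
    qed
  qed
  assume d: "d \<in> corners H" "vert_of G d = u"
  have "d \<in> ?Su \<union> {a, seg G a}"
    by (rule invariant_set_contains_circle[OF inv, of a]) (use d in auto)
  then show "d \<in> S"
    using d(1) unfolding in_corners_H by blast
qed

end

context contractible
begin

lemma edge_of_b: "edge_of G b = edge_of G a"
  using a_in by simp

lemmas contains_v_corners = contractible.contains_u_corners[OF other_end, unfolded edge_of_b rectangle_simps(7)]
lemmas no_v_corners_if_degenerate = contractible.no_corners_if_degenerate[OF other_end, unfolded edge_of_b rectangle_simps(7)]

lemma vert_of_H_inside: "vert_of G c \<in> {u, v} \<Longrightarrow> vert_of H c = w"
  and vert_of_H_outside: "vert_of G c \<notin> {u, v} \<Longrightarrow> vert_of H c = vert_of G c"
  by simp_all

text \<open>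
  The new boundary circle passes from \<open>u\<close> to \<open>v\<close> next to the contracted edge, so a set that is
  stable along it and meets \<open>u\<close> also meets \<open>v\<close>, unless \<open>v\<close> has no corner left.
\<close>

lemma contains_both_circles:
  assumes S: "S \<in> invariant_sets (corners H) (seg G) (arc H)"
    and c: "c \<in> S" "vert_of G c = u" and d: "d \<in> corners H" "vert_of G d \<in> {u, v}"
  shows "d \<in> S"
proof (cases "vert_of G d = u")
  case True
  then show ?thesis
    by (rule contains_u_corners(4)[OF S c d(1)])
next
  case False
  then have d_v: "vert_of G d = v"
    using d by blast
  then have nondeg: "arc G b \<noteq> seg G b"
    using no_v_corners_if_degenerate d(1) by blast
  have "arc H (arc G a) \<in> S"
    using contains_u_corners(2)[OF S c] by (rule invariant_setsD(3)[OF S])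
  then have "arc G b \<in> S"
    using arc_H_at_a(1)[OF contains_u_corners(1)[OF S c]] nondeg by simp
  then show ?thesis
    by (rule contains_v_corners(4)[OF S _ _ d(1) d_v]) simp
qed

lemmas contains_both_circles_from_v =
  contractible.contains_both_circles[OF other_end, unfolded edge_of_b rectangle_simps(7)]

text \<open>
  The contracted graph again has a single boundary circle at each disc: at the merged disc by the
  preceding lemma, and elsewhere because contraction changes nothing there.
\<close>

lemma invariant_set_is_merged_circle:
  assumes S: "S \<in> invariant_sets (corners H) (seg G) (arc H)"
    and c: "c \<in> S" and d: "d \<in> corners H" "vert_of H d = vert_of H c"
  shows "d \<in> S"
proof (cases "vert_of G c \<in> {u, v}")
  case True
  have "vert_of G d \<in> {u, v}"
    using True d(2) vert_of_H_inside[of c] vert_of_H_outside[of d] w_in by (metis insertCI)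
  moreover have "{v, u} = {u, v}"
    by blast
  ultimately show ?thesis
    using True contains_both_circles[OF S c _ d(1)] contains_both_circles_from_v[OF S c _ d(1)] by blast
next
  case False
  let ?S = "{x \<in> S. vert_of G x = vert_of G c}"
  have S_H: "S \<subseteq> corners H"
    using S by (rule invariant_setsD)
  have d_c: "vert_of G d = vert_of G c"
    using False d(2) vert_of_H_inside[of d] vert_of_H_outside[of c] vert_of_H_outside[of d] w_in
    by (metis insertCI)
  have "?S \<in> invariant_sets (corners G) (seg G) (arc G)"
  proof (rule invariant_setsI)
    show "?S \<subseteq> corners G"
      using S_H by auto
    fix x assume x: "x \<in> ?S"
    then have x_H: "x \<in> corners H" and x_G: "x \<in> corners G"
      using S_H by auto
    show "seg G x \<in> ?S"
      using x x_G invariant_setsD(2)[OF S] by simp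
    have "arc G x \<in> corners H"
      using x_H
    proof (cases rule: outside_cases)
      case 1
      then show ?thesis .
    qed (use x False in auto)
    then have "arc G x \<in> S"
      using x invariant_setsD(3)[OF S, of x] arc_H_away[of x] by (simp only: mem_Collect_eq)
    then show "arc G x \<in> ?S"
      using x x_G by simp
  qed
  then have "d \<in> ?S"
    by (rule invariant_set_contains_circle[of _ c]) (use c d S_H d_c in auto)
  then show ?thesis
    by blast
qed

lemma vert_of_arc_H: "c \<in> corners H \<Longrightarrow> vert_of H (arc H c) = vert_of H c"
proof -
  assume c: "c \<in> corners H"
  show ?thesis
    using c
  proof (cases rule: outside_cases)
    case 1
    then show ?thesis
      using c arc_H_away by simp
  qed (simp_all add: arc_H_at_a arc_H_at_b)
qed

lemma vert_of_seg_H: "c \<in> corners H \<Longrightarrow> vert_of H (seg G c) = vert_of H c"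
  by simp

lemma circle_pair_H: "involution_pair (corners H) (seg G) (arc H)"
  by unfold_locales (use finite_corners seg_H arc_H_involution in auto)

lemma face_pair_H: "involution_pair (corners H) (side G) (arc H)"
  by unfold_locales (use finite_corners side_H arc_H_involution in auto)

lemma vertex_circle_H:
  assumes c: "c \<in> corners H"
  shows "{d \<in> corners H. vert_of H d = vert_of H c} = orbit_rel (corners H) (seg G) (arc H) `` {c}"
proof
  let ?O = "orbit_rel (corners H) (seg G) (arc H) `` {c}"
  have O: "?O \<in> invariant_sets (corners H) (seg G) (arc H)"
    by (rule involution_pair.orbit_invariant[OF circle_pair_H c])
  have "c \<in> ?O"
    using involution_pair.equiv_orbit_rel[OF circle_pair_H] c by (rule equiv_class_self)
  then show "{d \<in> corners H. vert_of H d = vert_of H c} \<subseteq> ?O"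
    using invariant_set_is_merged_circle[OF O] by blast
  have inv: "{d \<in> corners H. vert_of H d = vert_of H c} \<in> invariant_sets (corners H) (seg G) (arc H)"
  proof (rule invariant_setsI)
    fix x assume x: "x \<in> {d \<in> corners H. vert_of H d = vert_of H c}"
    show "seg G x \<in> {d \<in> corners H. vert_of H d = vert_of H c}"
      using x seg_H[of x] vert_of_seg_H[of x] by (simp only: mem_Collect_eq simp_thms)
    show "arc H x \<in> {d \<in> corners H. vert_of H d = vert_of H c}"
      using x arc_H_involution[of x] vert_of_arc_H[of x] by (simp only: mem_Collect_eq simp_thms)
  qed blast
  show "?O \<subseteq> {d \<in> corners H. vert_of H d = vert_of H c}"
  proof
    fix d assume "d \<in> ?O"
    then have "(c, d) \<in> orbit_rel (corners H) (seg G) (arc H)"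
      by blast
    then show "d \<in> {d \<in> corners H. vert_of H d = vert_of H c}"
      by (rule orbit_rel_stays_in_invariant_set[OF inv]) (use c in blast)
  qed
qed

lemma ribbon_graph_contract: "ribbon_graph H"
proof (rule ribbon_graph.intro)
  fix c assume c: "c \<in> corners H"
  then have c_G: "c \<in> corners G" and c_e: "edge_of G c \<noteq> edge_of G a"
    by auto
  show "vert_of H c \<in> verts H"
    using vert_of_in[OF c_G] by simp
  show "seg H c \<in> corners H \<and> seg H c \<noteq> c \<and> seg H (seg H c) = c"
    using seg_H[OF c] by simp
  show "side H c \<in> corners H \<and> side H c \<noteq> c \<and> side H (side H c) = c"
    using side_H[OF c] by simp
  show "arc H c \<in> corners H \<and> arc H c \<noteq> c \<and> arc H (arc H c) = c"
    by (rule arc_H_involution[OF c])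
  show "side H c \<noteq> seg H c \<and> side H (seg H c) = seg H (side H c)"
    using rectangle[OF c_G] by simp
  have "{d \<in> corners H. edge_of H d = edge_of H c} = {d \<in> corners G. edge_of G d = edge_of G c}"
    using c_e by auto
  then show "{d \<in> corners H. edge_of H d = edge_of H c} = {c, seg H c, side H c, seg H (side H c)}"
    using ribbon_corners[OF c_G] by simp
  show "{d \<in> corners H. vert_of H d = vert_of H c} = orbit_rel (corners H) (seg H) (arc H) `` {c}"
    using vertex_circle_H[OF c] by simp
next
  show "edge_of H ` corners H = edges H"
    using edge_of_image by auto
qed (use finite_verts finite_edges finite_corners in auto)

end

section \<open>Faces under contraction\<close>

context contractible
begin

text \<open>
  From a corner of the contracted edge, the first corner of another edge that is met when going
  along the boundary through the side of that corner; any other corner is left alone. On corners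
  this is a retraction onto the corners of the contracted graph, provided that one of the two ends
  is not degenerate, and it moves every corner within its face.
\<close>

definition follow :: "'c \<Rightarrow> 'c" where
  "follow c = D (D c)"

lemma follow_outside: "c \<in> corners H \<Longrightarrow> follow c = c"
  unfolding follow_def by (rule retract_other) simp

lemma arc_H_follow: "arc H c = follow (arc G c)"
  by (simp add: arc_H follow_def)

lemma follow_in:
  assumes "\<not> (arc G a = seg G a \<and> arc G b = seg G b)" "c \<in> corners G"
  shows "follow c \<in> corners H"
proof (cases "edge_of G c = edge_of G a")
  case True
  then have "c \<in> {a, seg G a, b, seg G b}"
    using edge_of_eq_iff assms by blast
  then show ?thesis
    using assms(1) not_edge_iff by (auto simp: follow_def retract_simps)
next
  case False
  then show ?thesis
    using assms(2) by (simp add: follow_def)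
qed

text \<open>
  The two corners of a side lead to the two ends of one strand of the face, and contraction
  replaces this strand by a single arc.
\<close>

lemma arc_H_follow_side:
  assumes "\<not> (arc G a = seg G a \<and> arc G b = seg G b)" "c \<in> {a, seg G a, b, seg G b}"
  shows "arc H (follow (side G c)) = follow c"
  using assms by (auto simp: follow_def retract_simps arc_H degenerate_swap)

lemma follow_arc_in:
  assumes nondeg: "\<not> (arc G a = seg G a \<and> arc G b = seg G b)"
    and S: "S \<in> invariant_sets (corners H) (side G) (arc H)"
    and c: "c \<in> corners G" "follow c \<in> S"
  shows "follow (arc G c) \<in> S"
proof (cases "c \<in> corners H")
  case True
  then show ?thesis
    using c invariant_setsD(3)[OF S] by (metis arc_H_follow follow_outside)
next
  case False
  then have c_e: "c \<in> {a, seg G a, b, seg G b}"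
    using c unfolding in_corners_H by blast
  show ?thesis
  proof (cases "arc G c \<in> corners H")
    case True
    have "follow (arc G c) = arc G c"
      using True by (rule follow_outside)
    moreover have "arc H (arc G c) = follow c"
      using arc_involution[OF c(1)] by (simp add: arc_H_follow)
    moreover have "arc H (arc H (arc G c)) = arc G c"
      using arc_H_involution[OF True] by blast
    ultimately show ?thesis
      using invariant_setsD(3)[OF S c(2)] by simp
  next
    case False
    then have arc_c: "arc G c = seg G c"
      using c_e not_edge_iff degenerate_swap by auto
    have "follow (seg G c) = arc H (follow c)"
      using c_e arc_c nondeg by (auto simp: follow_def retract_simps arc_H degenerate_swap)
    then show ?thesis
      using arc_c invariant_setsD(3)[OF S c(2)] by simp
  qed
qed

lemma follow_side_in:
  assumes nondeg: "\<not> (arc G a = seg G a \<and> arc G b = seg G b)"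
    and S: "S \<in> invariant_sets (corners H) (side G) (arc H)"
    and c: "c \<in> corners G" "follow c \<in> S"
  shows "follow (side G c) \<in> S"
proof (cases "c \<in> corners H")
  case True
  then show ?thesis
    using c invariant_setsD(2)[OF S] side_H[OF True] by (metis follow_outside)
next
  case False
  then have c_e: "c \<in> {a, seg G a, b, seg G b}"
    using c unfolding in_corners_H by blast
  then have "side G c \<in> {a, seg G a, b, seg G b}"
    by auto
  then have "arc H (follow (side G (side G c))) = follow (side G c)"
    by (rule arc_H_follow_side[OF nondeg])
  then show ?thesis
    using side_involution[OF c(1)] invariant_setsD(3)[OF S c(2)] by simp
qed

text \<open>
  A union of faces is determined by its corners outside the contracted edge, since every face has
  such a corner: the inverse of restriction pulls back along \<open>follow\<close>.
\<close>

lemma bij_betw_face_sets: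
  assumes nondeg: "\<not> (arc G a = seg G a \<and> arc G b = seg G b)"
  shows "bij_betw (\<lambda>S. S \<inter> corners H) (invariant_sets (corners G) (side G) (arc G))
    (invariant_sets (corners H) (side G) (arc H))"
proof (rule bij_betw_byWitness[where f' = "\<lambda>S. {c \<in> corners G. follow c \<in> S}"])
  have D_in: "D x \<in> S" if S: "S \<in> invariant_sets (corners G) (side G) (arc G)" and "x \<in> S" for S x
    using that invariant_setsD(2,3)[OF S] by (simp add: detour_def)
  have D_out: "x \<in> S"
    if S: "S \<in> invariant_sets (corners G) (side G) (arc G)" and "D x \<in> S" "x \<in> corners G" for S x
  proof (cases "edge_of G x = edge_of G a")
    case True
    then have "side G (arc G (arc G (side G x))) \<in> S"
      using that invariant_setsD(2,3)[OF S] by (simp add: detour_def)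
    then show ?thesis
      using that(3) side_involution[of x] arc_involution[of "side G x"] by simp
  next
    case False
    then show ?thesis
      using that by (simp add: detour_def)
  qed
  have D_corner: "D x \<in> corners G" if "x \<in> corners G" for x
    using that side_involution[of x] arc_involution by (simp add: detour_def)
  have follow_iff: "follow x \<in> S \<longleftrightarrow> x \<in> S"
    if "S \<in> invariant_sets (corners G) (side G) (arc G)" "x \<in> corners G" for S x
    unfolding follow_def using that D_in D_out D_corner by blast
  show "\<forall>S\<in>invariant_sets (corners G) (side G) (arc G).
      {c \<in> corners G. follow c \<in> S \<inter> corners H} = S"
    using follow_iff follow_in[OF nondeg] invariant_setsD(1) by blast
  show "\<forall>S\<in>invariant_sets (corners H) (side G) (arc H).
      {c \<in> corners G. follow c \<in> S} \<inter> corners H = S"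
  proof
    fix S assume "S \<in> invariant_sets (corners H) (side G) (arc H)"
    then have "S \<subseteq> corners H"
      by (rule invariant_setsD)
    then show "{c \<in> corners G. follow c \<in> S} \<inter> corners H = S"
      using follow_outside by (auto simp del: contract_simps) (auto simp: in_corners_H)
  qed
  show "(\<lambda>S. S \<inter> corners H) ` invariant_sets (corners G) (side G) (arc G)
      \<subseteq> invariant_sets (corners H) (side G) (arc H)"
  proof (rule image_subsetI, rule invariant_setsI)
    fix S x assume S: "S \<in> invariant_sets (corners G) (side G) (arc G)" and x: "x \<in> S \<inter> corners H"
    then have x_H: "x \<in> corners H" and x_S: "x \<in> S" and arc_x: "arc G x \<in> S" "arc G x \<in> corners G"
      using invariant_setsD(1,3)[OF S] by auto
    show "side G x \<in> S \<inter> corners H"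
      using side_H[OF x_H] invariant_setsD(2)[OF S x_S] by blast
    have "arc H x \<in> S"
      unfolding arc_H_follow using arc_x follow_iff[OF S] by blast
    then show "arc H x \<in> S \<inter> corners H"
      using arc_H_involution[OF x_H] by blast
  qed blast
  show "(\<lambda>S. {c \<in> corners G. follow c \<in> S}) ` invariant_sets (corners H) (side G) (arc H)
      \<subseteq> invariant_sets (corners G) (side G) (arc G)"
  proof (rule image_subsetI, rule invariant_setsI)
    fix S x assume S: "S \<in> invariant_sets (corners H) (side G) (arc H)"
      and x: "x \<in> {c \<in> corners G. follow c \<in> S}"
    then have x_G: "x \<in> corners G" and f: "follow x \<in> S"
      by auto
    show "side G x \<in> {c \<in> corners G. follow c \<in> S}"
      using follow_side_in[OF nondeg S x_G f] side_involution[OF x_G] by blast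
    show "arc G x \<in> {c \<in> corners G. follow c \<in> S}"
      using follow_arc_in[OF nondeg S x_G f] arc_involution[OF x_G] by blast
  qed blast
qed

text \<open>
  The merged disc keeps a corner because one of the two ends is not degenerate.
\<close>

lemma isolated_verts_H:
  assumes nondeg: "\<not> (arc G a = seg G a \<and> arc G b = seg G b)"
  shows "verts H - vert_of H ` corners H = verts G - vert_of G ` corners G"
proof -
  obtain c where c: "c \<in> corners H" "vert_of G c \<in> {u, v}"
  proof (cases "arc G a = seg G a")
    case True
    then show ?thesis
      using that[of "arc G b"] nondeg not_edge_iff by simp
  next
    case False
    then show ?thesis
      using that[of "arc G a"] not_edge_iff by simp
  qed
  then have w: "w \<in> vert_of H ` corners H"
    using vert_of_H_inside by (metis imageI)
  have uv: "u \<in> vert_of G ` corners G" "v \<in> vert_of G ` corners G"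
    using a_in b_in by blast+
  have other: "x \<in> vert_of H ` corners H \<longleftrightarrow> x \<in> vert_of G ` corners G" if "x \<notin> {u, v}" for x
  proof
    assume "x \<in> vert_of H ` corners H"
    then obtain d where "d \<in> corners H" "x = vert_of H d"
      by blast
    then show "x \<in> vert_of G ` corners G"
      using that w_in vert_of_H_inside vert_of_H_outside in_corners_H by (metis imageI insertCI)
  next
    assume "x \<in> vert_of G ` corners G"
    then obtain d where d: "d \<in> corners G" "x = vert_of G d"
      by blast
    then have "d \<notin> {a, seg G a, b, seg G b}"
      using that by auto
    then show "x \<in> vert_of H ` corners H"
      using d that vert_of_H_outside in_corners_H by (metis imageI)
  qed
  show ?thesis
  proof (rule Set.set_eqI)
    fix x
    show "x \<in> verts H - vert_of H ` corners H \<longleftrightarrow> x \<in> verts G - vert_of G ` corners G"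
    proof (cases "x \<in> {u, v}")
      case True
      then have "x \<in> vert_of G ` corners G"
        using uv by (elim insertE emptyE) (simp_all only:)
      moreover have "x \<in> vert_of H ` corners H" if "x \<in> verts H"
      proof -
        have "x = w"
          using that True unfolding contract_simps by blast
        then show ?thesis
          using w by (simp only:)
      qed
      ultimately show ?thesis
        by blast
    next
      case False
      then have "x \<in> verts H \<longleftrightarrow> x \<in> verts G"
        using w_in unfolding contract_simps by blast
      then show ?thesis
        using other[OF False] by blast
    qed
  qed
qed

lemma card_face_orbits: "2 ^ card (corners G // orbit_rel (corners G) (side G) (arc G)) =
    card (invariant_sets (corners G) (side G) (arc G))"
  using involution_pair.card_invariant_sets[OF face_pair] by simp

lemma card_faces_H_nondegenerate:
  assumes nondeg: "\<not> (arc G a = seg G a \<and> arc G b = seg G b)"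
  shows "card (faces H) = card (faces G)"
proof -
  have "(2::nat) ^ card (corners H // orbit_rel (corners H) (side G) (arc H)) =
      2 ^ card (corners G // orbit_rel (corners G) (side G) (arc G))"
    using bij_betw_same_card[OF bij_betw_face_sets[OF nondeg]]
      involution_pair.card_invariant_sets[OF face_pair]
      involution_pair.card_invariant_sets[OF face_pair_H] by simp
  then have orbits: "card (corners H // orbit_rel (corners H) (side H) (arc H)) =
      card (corners G // orbit_rel (corners G) (side G) (arc G))"
    by simp
  have fin: "finite (corners H // orbit_rel (corners H) (side H) (arc H))"
    "finite (corners G // orbit_rel (corners G) (side G) (arc G))"
    "finite (verts G - vert_of G ` corners G)"
    using face_pair face_pair_H finite_corners finite_verts
    by (auto intro!: finite_quotient dest!: involution_pair.equiv_orbit_rel elim!: equivE)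
  show ?thesis
    unfolding faces_def isolated_verts_H[OF nondeg] using orbits fin by (simp add: card_Plus)
qed

end

context contractible
begin

text \<open>
  If both ends are degenerate the ribbon is an isolated edge with its two discs. This is a disc with
  one face, and its contraction is an isolated disc, whose face has no corner: the one case in
  which a face loses all its corners.
\<close>

lemma face_sets_degenerate:
  assumes deg: "arc G a = seg G a" "arc G b = seg G b" and C: "corners G = {a, seg G a, b, seg G b}"
  shows "invariant_sets (corners G) (side G) (arc G) = {{}, corners G}"
proof -
  have "S = {} \<or> S = corners G" if S: "S \<in> invariant_sets (corners G) (side G) (arc G)" for S
  proof -
    have step: "x \<in> S \<Longrightarrow> side G x \<in> S" "x \<in> S \<Longrightarrow> arc G x \<in> S" for x
      using invariant_setsD[OF S] by blast+
    have swap: "arc G (seg G a) = a" "arc G (seg G b) = b"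
      using deg degenerate_swap by blast+
    have "a \<in> S \<longleftrightarrow> b \<in> S" "a \<in> S \<longleftrightarrow> seg G a \<in> S" "b \<in> S \<longleftrightarrow> seg G b \<in> S"
      using step(1)[of a] step(1)[of b] step(2)[of a] step(2)[of "seg G a"] step(2)[of b] step(2)[of "seg G b"]
      unfolding deg swap rectangle_simps(7) by blast+
    then show ?thesis
      using invariant_setsD(1)[OF S] unfolding C by blast
  qed
  moreover have "corners G \<in> invariant_sets (corners G) (side G) (arc G)"
    by (rule invariant_setsI) (use side_involution arc_involution in auto)
  moreover have "{} \<in> invariant_sets (corners G) (side G) (arc G)"
    by (rule invariant_setsI) auto
  ultimately show ?thesis
    by blast
qed

lemma degenerate_connected:
  assumes deg: "arc G a = seg G a" "arc G b = seg G b" and conn: "card (comps G (edges G)) = 1"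
  shows "verts G = {u, v}" "corners G = {a, seg G a, b, seg G b}"
proof -
  have at_ends: "c \<in> {a, seg G a, b, seg G b}" if "c \<in> corners G" "vert_of G c \<in> {u, v}" for c
    using that no_corners_if_degenerate[OF deg(1), of c] no_v_corners_if_degenerate[OF deg(2), of c]
    unfolding in_corners_H by blast
  have uv: "u \<in> verts G" "v \<in> verts G"
    using a_in b_in vert_of_in by blast+
  have "y \<in> {u, v}" if "(u, y) \<in> (linked G (edges G))\<^sup>*" for y
    using that
  proof induction
    case (step y z)
    then obtain f where f: "ends G f = {y, z}"
      by (auto simp: linked_def)
    then have "y \<in> ends G f"
      by simp
    then obtain c where c: "c \<in> corners G" "edge_of G c = f" "vert_of G c = y"
      by (auto simp: ends_def)
    then have "f = edge_of G a"
      using at_ends[of c] step.IH a_in by auto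
    then show ?case
      using ends_e f by blast
  qed simp
  then show V: "verts G = {u, v}"
    using conn uv unfolding card_comps_eq_1_iff by blast
  show "corners G = {a, seg G a, b, seg G b}"
    using at_ends vert_of_in V a_in by auto
qed

lemma card_faces_H:
  assumes conn: "card (comps G (edges G)) = 1"
  shows "card (faces H) = card (faces G)"
proof (cases "arc G a = seg G a \<and> arc G b = seg G b")
  case True
  then have V: "verts G = {u, v}" and C: "corners G = {a, seg G a, b, seg G b}"
    using degenerate_connected conn by blast+
  have "(2::nat) ^ card (corners G // orbit_rel (corners G) (side G) (arc G)) = 2 ^ 1"
  proof -
    have "{} \<noteq> corners G"
      using a_in by blast
    then have "card {{}, corners G} = 2"
      by (simp only: card_2_iff) blast
    then show ?thesis
      using face_sets_degenerate[OF _ _ C] True card_face_orbits by (simp only: power_one_right)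
  qed
  then have "card (corners G // orbit_rel (corners G) (side G) (arc G)) = 1"
    by (simp only: power_inject_exp)
  moreover have "verts G - vert_of G ` corners G = {}"
    using V C by auto
  ultimately have G: "card (faces G) = 1"
    unfolding faces_def using finite_verts by (simp add: card_Plus_conv_if card_ge_0_finite)
  have "corners H = {}"
    using C in_corners_H by blast
  moreover have "verts H = {w}"
    unfolding contract_simps using V by blast
  ultimately have "faces H = {w} <+> {}"
    unfolding faces_def by (simp add: quotient_def del: contract_simps)
  then show ?thesis
    using G by (simp add: card_Plus)
next
  case False
  then show ?thesis
    by (rule card_faces_H_nondegenerate)
qed

definition merge :: "'v \<Rightarrow> 'v" where
  "merge x = (if x \<in> {u, v} then w else x)"

lemma ends_H: "f \<noteq> edge_of G a \<Longrightarrow> ends H f = merge ` ends G f"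
proof -
  assume "f \<noteq> edge_of G a"
  then have "{c \<in> corners H. edge_of H c = f} = {c \<in> corners G. edge_of G c = f}"
    by auto
  moreover have "vert_of H c = merge (vert_of G c)" for c
    by (simp add: merge_def)
  ultimately show ?thesis
    unfolding ends_def by (metis (no_types, lifting) image_cong image_image)
qed

lemma merge_idem: "x \<in> verts H \<Longrightarrow> merge x = x"
  using w_in by (auto simp: merge_def)

text \<open>
  Walks project to the contracted graph, where steps through the contracted edge become stationary.
\<close>

lemma merge_path:
  assumes "(x, y) \<in> (linked G A)\<^sup>*"
  shows "(merge x, merge y) \<in> (linked H (A - {edge_of G a}))\<^sup>*"
  using assms
proof induction
  case (step y z)
  then obtain f where f: "f \<in> A" "ends G f = {y, z}"
    by (auto simp: linked_def)
  show ?case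
  proof (cases "f = edge_of G a")
    case True
    then have "y \<in> {u, v}" "z \<in> {u, v}"
      using f ends_e by auto
    then have "merge y = merge z"
      by (simp only: merge_def if_True)
    then show ?thesis
      using step.IH by simp
  next
    case False
    then have "ends H f = {merge y, merge z}"
      using f by (simp add: ends_H)
    then have "(merge y, merge z) \<in> linked H (A - {edge_of G a})"
      using f False unfolding linked_def by blast
    then show ?thesis
      using step.IH by simp
  qed
qed simp

lemma merge_eq_path:
  assumes "merge x = merge y"
  shows "(x, y) \<in> (linked G (insert (edge_of G a) A))\<^sup>*"
proof -
  have "(u, v) \<in> linked G (insert (edge_of G a) A)" "(v, u) \<in> linked G (insert (edge_of G a) A)"
    using ends_e unfolding linked_def by blast+
  moreover have "x = y \<or> x \<in> {u, v} \<and> y \<in> {u, v}"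
    using assms w_in unfolding merge_def by (auto split: if_splits)
  ultimately show ?thesis
    by blast
qed

text \<open>
  Walks lift from the contracted graph if the contracted edge may be used, since it joins the two
  vertices that are identified.
\<close>

lemma lift_path:
  assumes "(p, q) \<in> (linked H A)\<^sup>*" "edge_of G a \<notin> A" "merge x = p" "merge y = q"
  shows "(x, y) \<in> (linked G (insert (edge_of G a) A))\<^sup>*"
  using assms(1,3,4)
proof (induction arbitrary: y)
  case base
  then show ?case
    using merge_eq_path by simp
next
  case (step q r)
  then obtain f where f: "f \<in> A" "ends H f = {q, r}"
    by (auto simp: linked_def)
  then have img: "merge ` ends G f = {q, r}"
    using ends_H assms(2) by metis
  obtain y0 z0 where yz: "ends G f = {y0, z0}" "merge y0 = q" "merge z0 = r"
  proof -
    have "ends G f \<noteq> {}"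
      using img by auto
    then obtain c where "c \<in> corners G" "edge_of G c = f"
      by (auto simp: ends_def)
    then have "ends G f = {vert_of G c, vert_of G (side G c)}"
      using ends_edge_of by blast
    then show thesis
      using that[of "vert_of G c" "vert_of G (side G c)"] that[of "vert_of G (side G c)" "vert_of G c"] img
      by (auto simp: doubleton_eq_iff insert_commute)
  qed
  have "(x, y0) \<in> (linked G (insert (edge_of G a) A))\<^sup>*"
    using step.IH step.prems(1) yz(2) by blast
  moreover have "(y0, z0) \<in> linked G (insert (edge_of G a) A)"
    using yz(1) f(1) unfolding linked_def by blast
  moreover have "(z0, y) \<in> (linked G (insert (edge_of G a) A))\<^sup>*"
    using merge_eq_path yz(3) step.prems(2) by simp
  ultimately show ?case
    by (meson rtrancl_into_rtrancl rtrancl_trans)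
qed

lemma connected_H:
  assumes "card (comps G A) = 1"
  shows "card (comps H (A - {edge_of G a})) = 1"
  unfolding card_comps_eq_1_iff
proof (intro conjI subsetI)
  show "verts H \<noteq> {}"
    by simp
  fix p assume "p \<in> verts H \<times> verts H"
  then obtain x y where p: "p = (x, y)" "x \<in> verts H" "y \<in> verts H"
    by blast
  moreover have "verts H \<subseteq> verts G"
    using w_in a_in b_in vert_of_in unfolding contract_simps by auto
  ultimately have "(x, y) \<in> (linked G A)\<^sup>*"
    using assms unfolding card_comps_eq_1_iff by blast
  then have "(merge x, merge y) \<in> (linked H (A - {edge_of G a}))\<^sup>*"
    by (rule merge_path)
  then show "p \<in> (linked H (A - {edge_of G a}))\<^sup>*"
    using p merge_idem by simp
qed

lemma tree_of_bridges_H: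
  assumes T: "tree_of_bridges G T" and e: "edge_of G a \<in> T"
  shows "tree_of_bridges H (T - {edge_of G a})"
  unfolding tree_of_bridges_def
proof (intro conjI ballI allI impI notI)
  show "T - {edge_of G a} \<subseteq> edges H"
    using T by (auto simp: tree_of_bridges_def)
  show "card (comps H (T - {edge_of G a})) = 1"
    using T by (intro connected_H) (simp add: tree_of_bridges_def)
  fix f p q
  assume f: "f \<in> T - {edge_of G a}" "ends H f = {p, q}"
    and path: "(p, q) \<in> (linked H (T - {edge_of G a} - {f}))\<^sup>*"
  have "f \<in> edges G"
    using f T by (auto simp: tree_of_bridges_def)
  then obtain c where c: "c \<in> corners G" "edge_of G c = f"
    using edge_of_image by (metis imageE)
  have ends_f: "ends G f = {vert_of G c, vert_of G (side G c)}"
    using ends_edge_of[OF c(1)] c(2) by simp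
  have "ends H f = merge ` ends G f"
    using f(1) by (intro ends_H) blast
  then have img: "{merge (vert_of G c), merge (vert_of G (side G c))} = {p, q}"
    unfolding f(2) ends_f by simp
  have path': "(q, p) \<in> (linked H (T - {edge_of G a} - {f}))\<^sup>*"
    using path sym_rtrancl[OF sym_linked] by (meson symD)
  have outside: "edge_of G a \<notin> T - {edge_of G a} - {f}"
    by blast
  have "merge (vert_of G c) = p \<and> merge (vert_of G (side G c)) = q \<or>
      merge (vert_of G c) = q \<and> merge (vert_of G (side G c)) = p"
    using img by (simp only: doubleton_eq_iff)
  then have "(vert_of G c, vert_of G (side G c)) \<in> (linked G (insert (edge_of G a) (T - {edge_of G a} - {f})))\<^sup>*"
    using lift_path[OF path outside] lift_path[OF path' outside] by blast
  moreover have "insert (edge_of G a) (T - {edge_of G a} - {f}) = T - {f}"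
    using e f by blast
  ultimately show False
    using T f(1) ends_f unfolding tree_of_bridges_def by (metis DiffD1)
qed

lemma card_verts_H: "card (verts G) = Suc (card (verts H))"
proof -
  have "u \<in> verts G" "v \<in> verts G"
    using a_in b_in vert_of_in by blast+
  then have "card (verts G - {u, v}) + 2 = card (verts G)"
    using no_loop finite_verts card_mono[of "verts G" "{u, v}"] by (simp add: card_Diff_subset)
  moreover have "w \<notin> verts G - {u, v}"
    using w_in by blast
  ultimately show ?thesis
    using finite_verts by simp
qed

lemma card_edges_H: "card (edges G) = Suc (card (edges H))"
  using finite_edges edge_of_image a_in by (metis card.remove contract_simps(2) imageI)

lemma euler_genus_H:
  assumes conn: "card (comps G (edges G)) = 1"
  shows "euler_genus H = euler_genus G"
proof -
  have "card (comps H (edges H)) = 1"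
    using connected_H[OF conn] by simp
  then show ?thesis
    using conn card_faces_H[OF conn] card_verts_H card_edges_H
    unfolding euler_genus_def euler_char_def by linarith
qed

end

section \<open>The auxiliary bouquet\<close>

lemma (in ribbon_graph) contractible_tree_edge:
  assumes T: "tree_of_bridges G T" and e: "e \<in> T"
  obtains a where "contractible G a" "edge_of G a = e"
proof -
  have "e \<in> edges G"
    using assms by (auto simp: tree_of_bridges_def)
  then obtain a where a: "a \<in> corners G" "edge_of G a = e"
    using edge_of_image by (metis imageE)
  have "ends G e = {vert_of G a, vert_of G (side G a)}"
    using ends_edge_of[OF a(1)] a(2) by simp
  then have "(vert_of G a, vert_of G (side G a)) \<notin> (linked G (T - {e}))\<^sup>*"
    using T e unfolding tree_of_bridges_def by blast
  then have "vert_of G a \<noteq> vert_of G (side G a)"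
    by (metis rtrancl.rtrancl_refl)
  then have "contractible G a"
    by unfold_locales (rule a)
  then show thesis
    using that a by blast
qed

lemma tree_of_bridges_connected:
  assumes "tree_of_bridges G T"
  shows "card (comps G (edges G)) = 1"
proof -
  have "linked G T \<subseteq> linked G (edges G)"
    using assms by (intro linked_mono) (simp add: tree_of_bridges_def)
  then show ?thesis
    using assms rtrancl_mono unfolding tree_of_bridges_def card_comps_eq_1_iff by blast
qed

lemma tree_of_bridges_twist [simp]: "tree_of_bridges (twist G X) T = tree_of_bridges G T"
  by (simp add: tree_of_bridges_def)

text \<open>
  Contracting the edges one at a time keeps the remaining ones bridges of a connected tree, and when
  none is left a connected graph without tree edges has one vertex.
\<close>

lemma fold_contract:
  assumes "ribbon_graph G" "tree_of_bridges G (set ts)" "distinct ts"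
  shows "ribbon_graph (fold (\<lambda>e H. contract H e) ts G)"
    "card (verts (fold (\<lambda>e H. contract H e) ts G)) = 1"
    "edges (fold (\<lambda>e H. contract H e) ts G) = edges G - set ts"
    "euler_genus (fold (\<lambda>e H. contract H e) ts G) = euler_genus G"
proof -
  let ?F = "fold (\<lambda>e H. contract H e)"
  have "ribbon_graph (?F ts G) \<and> card (verts (?F ts G)) = 1 \<and> edges (?F ts G) = edges G - set ts
      \<and> euler_genus (?F ts G) = euler_genus G"
    using assms
  proof (induction ts arbitrary: G)
    case Nil
    then show ?case
      using card_verts_tree_of_no_edges by auto
  next
    case (Cons e ts)
    interpret ribbon_graph G
      by fact
    obtain a where a: "contractible G a" and e: "edge_of G a = e"
      using contractible_tree_edge[OF Cons.prems(2), of e] by auto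
    have remaining: "set (e # ts) - {e} = set ts"
      using Cons.prems(3) by auto
    have "tree_of_bridges (contract G e) (set ts)"
      using contractible.tree_of_bridges_H[OF a Cons.prems(2)] e remaining by simp
    moreover have "ribbon_graph (contract G e)"
      using contractible.ribbon_graph_contract[OF a] e by simp
    moreover have "euler_genus (contract G e) = euler_genus G"
      using contractible.euler_genus_H[OF a tree_of_bridges_connected[OF Cons.prems(2)]] e by simp
    moreover have "edges (contract G e) = edges G - {e}"
      using contractible.contract_simps(2)[OF a] e by simp
    ultimately show ?case
      using Cons.IH[of "contract G e"] Cons.prems(3) by auto
  qed
  then show "ribbon_graph (?F ts G)" "card (verts (?F ts G)) = 1"
    "edges (?F ts G) = edges G - set ts" "euler_genus (?F ts G) = euler_genus G"
    by blast+
qed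

text \<open>
  Contraction uses the sides of the contracted edge only.
\<close>

lemma twist_contract:
  assumes "e \<notin> Y"
  shows "twist (contract G e) Y = contract (twist G Y) e"
proof -
  have detour: "detour (twist G Y) e = detour G e"
  proof
    show "detour (twist G Y) e c = detour G e c" for c
      using assms by (cases "edge_of G c = e") (simp_all add: detour_def)
  qed
  show ?thesis
    unfolding contract_def Let_def ends_twist detour
    by (rule ribbon.equality) (simp_all add: fun_eq_iff)
qed

lemma twist_fold_contract:
  assumes "set ts \<inter> Y = {}"
  shows "twist (fold (\<lambda>e H. contract H e) ts G) Y = fold (\<lambda>e H. contract H e) ts (twist G Y)"
  using assms
proof (induction ts arbitrary: G)
  case (Cons e ts)
  then show ?case
    using twist_contract[of e Y G] by simp
qed simp

lemma orbit_rel_cong: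
  assumes "\<And>c. c \<in> C \<Longrightarrow> f c = f' c"
  shows "orbit_rel C f g = orbit_rel C f' g"
proof -
  have "{(z, f z) | z. z \<in> C} = {(z, f' z) | z. z \<in> C}"
    using assms by auto
  then show ?thesis
    by (simp add: orbit_rel_def)
qed

text \<open>
  The two graphs agree on corners but need not be equal as records, because nothing is known about
  \<open>seg\<close> and \<open>edge_of\<close> outside the corners.
\<close>

lemma (in ribbon_graph) euler_genus_twist_twist:
  assumes "X \<inter> Y = {}"
  shows "euler_genus (twist (twist G X) Y) = euler_genus (twist G (X \<union> Y))"
proof -
  have "side (twist (twist G X) Y) c = side (twist G (X \<union> Y)) c" if "c \<in> corners G" for c
    using assms that by auto
  then have "orbit_rel (corners G) (side (twist (twist G X) Y)) (arc G) =
      orbit_rel (corners G) (side (twist G (X \<union> Y))) (arc G)"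
    by (rule orbit_rel_cong)
  then show ?thesis
    by (simp add: euler_genus_def euler_char_def faces_def)
qed

lemma some_list_of_finite_set:
  assumes "finite T"
  shows "distinct (SOME ts. distinct ts \<and> set ts = T)" "set (SOME ts. distinct ts \<and> set ts = T) = T"
  using someI_ex[of "\<lambda>ts. distinct ts \<and> set ts = T"] finite_distinct_list[OF assms] by blast+

lemma Aux_properties:
  assumes "ribbon_graph G" "tree_of_bridges G T" "finite T"
  shows "ribbon_graph (Aux G T)" "card (verts (Aux G T)) = 1" "edges (Aux G T) = edges G - T"
    "euler_genus (Aux G T) = euler_genus G"
  using fold_contract[OF assms(1), of "SOME ts. distinct ts \<and> set ts = T"]
    assms(2) some_list_of_finite_set[OF assms(3)] by (simp_all add: Aux_def)

lemma twist_Aux: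
  assumes "finite T" "T \<inter> Y = {}"
  shows "twist (Aux G T) Y = Aux (twist G Y) T"
  unfolding Aux_def
  by (rule twist_fold_contract) (unfold some_list_of_finite_set(2)[OF assms(1)], fact assms(2))

section \<open>The boundary circle of a bouquet\<close>

context ribbon_graph
begin

lemma card_corners: "card (corners G) = 4 * card (edges G)"
proof -
  have four: "card {d \<in> corners G. edge_of G d = e} = 4" if "e \<in> edges G" for e
  proof -
    obtain c where c: "c \<in> corners G" "edge_of G c = e"
      using edge_of_image \<open>e \<in> edges G\<close> by (metis imageE)
    have side: "side G c \<in> corners G" "side G c \<noteq> c" "seg G c \<noteq> c" "side G c \<noteq> seg G c" "seg G (side G c) \<noteq> side G c"
      using seg_involution side_involution rectangle c(1) by blast+
    have "seg G (side G c) \<noteq> c"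
      using side_neq_seg_side[OF c(1)] rectangle[OF c(1)] by simp
    moreover have "seg G (side G c) \<noteq> seg G c"
      using side c(1) seg_involution by metis
    ultimately have "card {c, seg G c, side G c, seg G (side G c)} = 4"
      using side by (simp add: card_insert_if eq_commute)
    then show ?thesis
      using ribbon_corners[OF c(1)] c(2) by simp
  qed
  have "corners G = (\<Union>e\<in>edges G. {d \<in> corners G. edge_of G d = e})"
    using edge_of_image by blast
  then have "card (corners G) = (\<Sum>e\<in>edges G. card {d \<in> corners G. edge_of G d = e})"
    using card_UN_disjoint[of "edges G" "\<lambda>e. {d \<in> corners G. edge_of G d = e}"]
      finite_edges finite_corners by auto
  then show ?thesis
    using four by simp
qed

end

text \<open>
  The base corner \<open>c0\<close> fixes a starting point and a direction on the boundary circle of the disc.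
\<close>

locale bouquet = ribbon_graph B for B :: "('v, 'e, 'c) ribbon" +
  fixes c0 :: 'c
  assumes one_vertex: "card (verts B) = 1" and base_in: "c0 \<in> corners B"
begin

abbreviation "len \<equiv> 2 * card (edges B)"

text \<open>
  The corners at which consecutive segments are entered when going around the disc from \<open>c0\<close>;
  \<open>seg (walk i)\<close> is the corner at which the \<open>i\<close>-th segment is left.
\<close>

definition walk :: "nat \<Rightarrow> 'c" where
  "walk i = ((arc B \<circ> seg B) ^^ i) c0"

lemma walk_0: "walk 0 = c0"
  by (simp add: walk_def)

lemma walk_Suc: "walk (Suc i) = arc B (seg B (walk i))"
  by (simp add: walk_def)

lemma walk_in: "walk i \<in> corners B"
proof (induction i)
  case 0
  then show ?case
    using base_in by (simp add: walk_0)
next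
  case (Suc i)
  then show ?case
    using seg_involution arc_involution by (simp add: walk_Suc)
qed

lemma seg_walk_in: "seg B (walk i) \<in> corners B"
  using walk_in seg_involution by blast

lemma seg_seg_walk: "seg B (seg B (walk i)) = walk i"
  using walk_in seg_involution by blast

lemma arc_walk_Suc: "arc B (walk (Suc i)) = seg B (walk i)"
  using seg_walk_in arc_involution by (simp add: walk_Suc)

text \<open>
  The circle is never traversed backwards: if a segment were left at a corner where a later one is
  entered, the same would hold for the segment after the first and the one before the second, and
  closing in on the middle would produce a fixed point of \<open>seg\<close> or of \<open>arc\<close>.
\<close>

lemma seg_walk_neq_later: "seg B (walk i) \<noteq> walk (i + k)"
proof (induction k arbitrary: i rule: less_induct)
  case (less k)
  consider "k = 0" | "k = 1" | k' where "k = Suc (Suc k')"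
    by (metis One_nat_def not0_implies_Suc)
  then show ?case
  proof cases
    case 1
    then show ?thesis
      using walk_in seg_involution by simp
  next
    case 2
    then show ?thesis
      using arc_involution[OF seg_walk_in[of i]] by (simp add: walk_Suc eq_commute)
  next
    case 3
    show ?thesis
    proof
      assume "seg B (walk i) = walk (i + k)"
      then have "walk (Suc i) = seg B (walk (Suc i + k'))"
        using 3 arc_walk_Suc[of "Suc i + k'"] by (simp add: walk_Suc)
      then have "seg B (walk (Suc i)) = walk (Suc i + k')"
        using seg_seg_walk by simp
      then show False
        using less.IH[of k' "Suc i"] 3 by simp
    qed
  qed
qed

lemma seg_walk_neq: "seg B (walk i) \<noteq> walk j"
proof (cases "i \<le> j")
  case True
  then show ?thesis
    using seg_walk_neq_later[of i "j - i"] by simp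
next
  case False
  then show ?thesis
    using seg_walk_neq_later[of j "i - j"] seg_seg_walk[of i] by auto
qed

lemma walk_cancel: "walk (Suc i) = walk (Suc j) \<Longrightarrow> walk i = walk j"
  by (metis arc_walk_Suc seg_seg_walk)

lemma walk_cancel_add: "walk (i + k) = walk (j + k) \<Longrightarrow> walk i = walk j"
  by (induction k) (auto dest: walk_cancel)

definition period :: nat where
  "period = (LEAST n. n > 0 \<and> walk n = c0)"

lemma period: "period > 0" "walk period = c0"
proof -
  have "\<not> inj_on walk UNIV"
    using finite_corners walk_in by (metis finite_imageD finite_subset image_subsetI infinite_UNIV_nat)
  then obtain i j where "i < j" "walk i = walk j"
    by (metis injI linorder_neqE_nat)
  then have "walk (0 + i) = walk (j - i + i)"
    by simp
  then have "walk (j - i) = c0"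
    using walk_cancel_add walk_0 by metis
  then have "\<exists>n. n > 0 \<and> walk n = c0"
    using \<open>i < j\<close> by (intro exI[of _ "j - i"]) simp
  then show "period > 0" "walk period = c0"
    unfolding period_def using LeastI_ex[of "\<lambda>n. n > 0 \<and> walk n = c0"] by blast+
qed

lemma inj_walk: "inj_on walk {..<period}"
proof (rule linorder_inj_onI)
  fix i j assume ij: "i < j" "i \<in> {..<period}" "j \<in> {..<period}"
  show "walk i \<noteq> walk j"
  proof
    assume "walk i = walk j"
    then have "walk (0 + i) = walk (j - i + i)"
      using ij by simp
    then have "walk (j - i) = c0"
      using walk_cancel_add walk_0 by metis
    moreover have "j - i < period" "j - i > 0"
      using ij by auto
    ultimately show False
      unfolding period_def using not_less_Least by blast
  qed
qed auto

lemma walk_mod_period: "walk (i mod period) = walk i"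
  unfolding walk_def by (rule funpow_mod_eq) (use period(2) in \<open>simp add: walk_def\<close>)

lemma range_walk: "range walk = walk ` {..<period}"
proof
  show "range walk \<subseteq> walk ` {..<period}"
    using walk_mod_period period(1) by (metis image_eqI image_subsetI lessThan_iff mod_less_divisor)
qed auto

text \<open>
  Since there is only one disc, the walk crosses all segments, and every corner is an entry or an
  exit.
\<close>

lemma corners_walk: "corners B = range walk \<union> seg B ` range walk"
proof
  have "range walk \<union> seg B ` range walk \<in> invariant_sets (corners B) (seg B) (arc B)"
  proof (rule invariant_setsI)
    show "range walk \<union> seg B ` range walk \<subseteq> corners B"
      using walk_in seg_walk_in by blast
    fix x assume x: "x \<in> range walk \<union> seg B ` range walk"
    show "seg B x \<in> range walk \<union> seg B ` range walk"
      using x seg_seg_walk by auto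
    have "arc B (walk i) \<in> range walk \<union> seg B ` range walk" for i
    proof (cases i)
      case 0
      then have "walk i = walk (Suc (period - 1))"
        using period walk_0 by simp
      then show ?thesis
        using arc_walk_Suc by auto
    next
      case (Suc k)
      then show ?thesis
        using arc_walk_Suc by auto
    qed
    moreover have "arc B (seg B (walk i)) \<in> range walk" for i
      using walk_Suc[of i] by (metis rangeI)
    ultimately show "arc B x \<in> range walk \<union> seg B ` range walk"
      using x by blast
  qed
  moreover have "c0 \<in> range walk \<union> seg B ` range walk"
    using walk_0 by (metis UnI1 rangeI)
  moreover have "vert_of B d = vert_of B c0" if "d \<in> corners B" for d
    using one_vertex vert_of_in[OF that] vert_of_in[OF base_in] by (metis card_1_singletonE singletonD)
  ultimately show "corners B \<subseteq> range walk \<union> seg B ` range walk"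
    using invariant_set_contains_circle by blast
qed (use walk_in seg_walk_in in blast)

lemma period_eq: "period = len"
proof -
  have "inj_on (seg B) (range walk)"
    by (rule inj_on_inverseI[where g = "seg B"]) (use seg_seg_walk in blast)
  then have "card (seg B ` range walk) = period"
    using inj_walk by (simp add: card_image range_walk)
  moreover have "card (range walk) = period"
    using inj_walk by (simp add: card_image range_walk)
  moreover have "range walk \<inter> seg B ` range walk = {}"
    using seg_walk_neq seg_walk_neq[symmetric] by blast
  ultimately have "card (corners B) = 2 * period"
    unfolding corners_walk by (subst card_Un_disjoint) (auto simp: range_walk)
  then show ?thesis
    using card_corners by simp
qed

lemma walk_eq_iff: "i < len \<Longrightarrow> j < len \<Longrightarrow> walk i = walk j \<longleftrightarrow> i = j"
  using inj_walk unfolding period_eq by (auto dest: inj_onD)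

lemma walk_mod: "walk (i mod len) = walk i"
  using walk_mod_period unfolding period_eq .

lemma walk_len: "walk len = c0"
  using period(2) unfolding period_eq .

lemma len_pos: "len > 0"
  using period(1) unfolding period_eq .

lemma corner_cases:
  assumes "c \<in> corners B"
  obtains i where "i < len" "c = walk i" | i where "i < len" "c = seg B (walk i)"
  using assms unfolding corners_walk range_walk period_eq by auto

end

section \<open>Interlacement in the boundary word\<close>

text \<open>
  The pattern of two interlaced loops. It is stable under rotation and reversal of the word, so it
  may be tested from any base corner and in either direction.
\<close>

definition alternating :: "'a \<Rightarrow> 'a \<Rightarrow> 'a list \<Rightarrow> bool" where
  "alternating e f xs \<longleftrightarrow> xs = [e, f, e, f] \<or> xs = [f, e, f, e]"

lemma alternating_rotate1: "alternating e f (rotate1 xs) \<longleftrightarrow> alternating e f xs"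
proof -
  have "ys @ [y] = [p, q, p, q] \<longleftrightarrow> y # ys = [q, p, q, p]" for y p q :: 'a and ys
    using append_eq_append_conv[of ys "[p, q, p]" "[y]" "[q]"] by auto
  then show ?thesis
    by (cases xs) (auto simp: alternating_def)
qed

lemma alternating_rev: "alternating e f (rev xs) \<longleftrightarrow> alternating e f xs"
  by (auto simp: alternating_def rev_swap)

lemma alternating_filter_rotate:
  "alternating e f (filter P (rotate k xs)) \<longleftrightarrow> alternating e f (filter P xs)"
proof (induction k)
  case (Suc k)
  have "alternating e f (filter P (rotate1 ys)) \<longleftrightarrow> alternating e f (filter P ys)" for ys
  proof (cases ys)
    case (Cons y zs)
    then show ?thesis
      using alternating_rotate1[of e f "filter P ys"] by (cases "P y") simp_all
  qed simp
  then show ?case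
    using Suc by (simp add: rotate_def)
qed simp

lemma filter_rotate_Cons:
  assumes "filter P xs = y # ys"
  obtains k where "filter P (rotate k xs) = ys @ [y]"
proof -
  obtain us vs where xs: "xs = us @ y # vs" and "\<forall>u\<in>set us. \<not> P u" "P y" "ys = filter P vs"
    using assms by (auto simp: filter_eq_Cons_iff)
  moreover have "rotate (length (us @ [y])) xs = vs @ us @ [y]"
    using rotate_append[of "us @ [y]" vs] xs by simp
  ultimately have "filter P (rotate (length (us @ [y])) xs) = ys @ [y]"
    by (simp add: filter_empty_conv)
  then show thesis
    by (rule that)
qed

lemma filter_doubleton:
  assumes "e \<notin> set xs"
  shows "filter (\<lambda>g. g = e \<or> g = f) xs = replicate (count_list xs f) f"
  using assms by (induction xs) auto

lemma alternating_iff_one_between: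
  assumes "e \<noteq> f" and e: "e \<notin> set xs" "e \<notin> set ys" "e \<notin> set zs"
    and f: "count_list (xs @ e # ys @ e # zs) f = 2"
  shows "alternating e f (filter (\<lambda>g. g = e \<or> g = f) (xs @ e # ys @ e # zs)) \<longleftrightarrow> count_list ys f = 1"
proof -
  define p q r where pqr: "p = count_list xs f" "q = count_list ys f" "r = count_list zs f"
  have filter: "filter (\<lambda>g. g = e \<or> g = f) (xs @ e # ys @ e # zs) =
      replicate p f @ e # replicate q f @ e # replicate r f"
    using filter_doubleton[OF e(1)] filter_doubleton[OF e(2)] filter_doubleton[OF e(3)]
    by (simp add: pqr)
  have r: "r = 2 - p - q" and "p + q \<le> 2"
    using f \<open>e \<noteq> f\<close> unfolding pqr by (simp_all split: if_splits)
  then have "p = 0 \<or> p = 1 \<or> p = 2" "q = 0 \<or> q = 1 \<or> q = 2"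
    by linarith+
  with \<open>p + q \<le> 2\<close> show ?thesis
    unfolding filter pqr(2)[symmetric] r
    using \<open>e \<noteq> f\<close> by (elim disjE) (simp_all add: alternating_def numeral_2_eq_2)
qed

context bouquet
begin

lemma boundary_word_step:
  assumes "((arc B \<circ> seg B) ^^ len) c = c"
  shows "boundary_word B (((arc B \<circ> seg B) ^^ k) c) = rotate k (boundary_word B c)"
proof (rule nth_equalityI)
  let ?p = "arc B \<circ> seg B"
  fix i assume i: "i < length (boundary_word B ((?p ^^ k) c))"
  then have i_len: "i < len"
    by (simp add: boundary_word_def)
  have "boundary_word B ((?p ^^ k) c) ! i = edge_of B ((?p ^^ i) ((?p ^^ k) c))"
    using i_len by (simp add: boundary_word_def)
  also have "(?p ^^ i) ((?p ^^ k) c) = (?p ^^ (k + i)) c"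
    by (simp only: funpow_add comp_apply add.commute[of k i])
  also have "\<dots> = (?p ^^ ((k + i) mod len)) c"
    by (rule funpow_mod_eq[OF assms, symmetric])
  also have "edge_of B \<dots> = boundary_word B c ! ((k + i) mod len)"
    using len_pos by (simp add: boundary_word_def)
  also have "\<dots> = rotate k (boundary_word B c) ! i"
    using i_len nth_rotate[of i "boundary_word B c" k] by (simp add: boundary_word_def)
  finally show "boundary_word B ((?p ^^ k) c) ! i = rotate k (boundary_word B c) ! i" .
qed (simp add: boundary_word_def)

text \<open>
  Started at an exit corner, the successor map of the boundary word runs around the disc in the
  opposite direction.
\<close>

lemma walk_backwards:
  assumes "i \<le> j"
  shows "((arc B \<circ> seg B) ^^ i) (seg B (walk j)) = seg B (walk (j - i))"
  using assms
proof (induction i)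
  case (Suc i)
  then have "j - i = Suc (j - Suc i)"
    by simp
  then show ?case
    using Suc seg_seg_walk[of "j - i"] arc_walk_Suc[of "j - Suc i"] by simp
qed simp

abbreviation "word \<equiv> boundary_word B c0"

lemma length_word: "length word = len"
  by (simp add: boundary_word_def)

lemma word_nth: "i < len \<Longrightarrow> word ! i = edge_of B (walk i)"
  by (simp add: boundary_word_def walk_def)

lemma boundary_word_backwards: "boundary_word B (seg B (walk (len - 1))) = rev word"
proof (rule nth_equalityI)
  fix i assume "i < length (boundary_word B (seg B (walk (len - 1))))"
  then have i: "i < len"
    by (simp add: boundary_word_def)
  then have "boundary_word B (seg B (walk (len - 1))) ! i = edge_of B (seg B (walk (len - 1 - i)))"
    using walk_backwards[of i "len - 1"] by (simp add: boundary_word_def)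
  also have "\<dots> = edge_of B (walk (len - 1 - i))"
    by (rule edge_of_seg[OF walk_in])
  also have "\<dots> = rev word ! i"
    using i word_nth[of "len - 1 - i"] by (simp add: rev_nth length_word)
  finally show "boundary_word B (seg B (walk (len - 1))) ! i = rev word ! i" .
qed (simp add: boundary_word_def)

lemma alternating_boundary_word:
  assumes "c \<in> corners B"
  shows "alternating e f (filter P (boundary_word B c)) \<longleftrightarrow> alternating e f (filter P word)"
  using assms
proof (cases rule: corner_cases)
  case (1 i)
  have "boundary_word B (walk i) = rotate i word"
    unfolding walk_def using walk_len by (intro boundary_word_step) (simp add: walk_def)
  then show ?thesis
    using 1 alternating_filter_rotate by metis
next
  case (2 i)
  \<comment> \<open>The word of \<open>d\<close> is the reversed word of \<open>c0\<close>, and \<open>c\<close> lies on the backward walk from \<open>d\<close>.\<close>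
  define d where "d = seg B (walk (len - 1))"
  have "((arc B \<circ> seg B) ^^ (len - 1)) d = seg B (walk 0)"
    unfolding d_def using walk_backwards[of "len - 1" "len - 1"] by simp
  moreover have "arc B (walk 0) = d"
    unfolding d_def using arc_walk_Suc[of "len - 1"] walk_len walk_0 len_pos by simp
  ultimately have "((arc B \<circ> seg B) ^^ Suc (len - 1)) d = d"
    unfolding funpow.simps comp_apply using seg_seg_walk[of 0] by (simp only:)
  then have period: "((arc B \<circ> seg B) ^^ len) d = d"
    using Suc_diff_1[OF len_pos] by (simp only:)
  have "((arc B \<circ> seg B) ^^ (len - 1 - i)) d = seg B (walk (len - 1 - (len - 1 - i)))"
    unfolding d_def by (rule walk_backwards) simp
  also have "len - 1 - (len - 1 - i) = i"
    using 2(1) by simp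
  finally have "boundary_word B c = rotate (len - 1 - i) (rev word)"
    using boundary_word_step[OF period, of "len - 1 - i"] boundary_word_backwards 2(2) d_def
    by (simp only:)
  then have "alternating e f (filter P (boundary_word B c)) \<longleftrightarrow> alternating e f (filter P (rev word))"
    using alternating_filter_rotate by metis
  then show ?thesis
    using alternating_rev[of e f "filter P word"] by (simp add: rev_filter)
qed

lemma interlaced_iff_alternating:
  "interlaced B e f \<longleftrightarrow> e \<noteq> f \<and> alternating e f (filter (\<lambda>g. g = e \<or> g = f) word)"
proof
  assume "interlaced B e f"
  then obtain c where "e \<noteq> f" "c \<in> corners B"
    "filter (\<lambda>g. g = e \<or> g = f) (boundary_word B c) = [e, f, e, f]"
    by (auto simp: interlaced_def)
  then show "e \<noteq> f \<and> alternating e f (filter (\<lambda>g. g = e \<or> g = f) word)"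
    using alternating_boundary_word[of c e f "\<lambda>g. g = e \<or> g = f"] by (simp add: alternating_def)
next
  let ?P = "\<lambda>g. g = e \<or> g = f"
  assume "e \<noteq> f \<and> alternating e f (filter ?P word)"
  then consider "e \<noteq> f" "filter ?P word = [e, f, e, f]" | "e \<noteq> f" "filter ?P word = [f, e, f, e]"
    by (auto simp: alternating_def)
  then show "interlaced B e f"
  proof cases
    case 1
    then show ?thesis
      using base_in by (auto simp: interlaced_def)
  next
    case 2
    \<comment> \<open>Moving the base corner past the first occurrence of \<open>f\<close> makes the pattern start with \<open>e\<close>.\<close>
    obtain k where "filter ?P (rotate k word) = [e, f, e] @ [f]"
      using filter_rotate_Cons[OF 2(2)] by blast
    moreover have "boundary_word B (walk k) = rotate k word"
      unfolding walk_def using walk_len by (intro boundary_word_step) (simp add: walk_def)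
    ultimately show ?thesis
      using 2(1) walk_in unfolding interlaced_def by (metis append_Cons append_Nil)
  qed
qed

text \<open>
  A loop is twisted iff its sides join entry to entry and exit to exit; on an untwisted loop, as in
  a planar annulus, each side joins an exit to an entry. The notion does not change when the
  direction of the walk is reversed.
\<close>

definition twisted :: "'e \<Rightarrow> bool" where
  "twisted e \<longleftrightarrow> (\<exists>i. edge_of B (walk i) = e \<and> side B (walk i) \<in> range walk)"

text \<open>
  Of the four corners of a loop two are entries, one at each end.
\<close>

lemma obtain_positions:
  assumes "e \<in> edges B"
  obtains i j where "i < j" "j < len" "edge_of B (walk i) = e" "edge_of B (walk j) = e"
    "{k. k < len \<and> edge_of B (walk k) = e} = {i, j}"
    "twisted e \<Longrightarrow> side B (walk i) = walk j" "\<not> twisted e \<Longrightarrow> side B (walk i) = seg B (walk j)"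
proof -
  obtain c where c: "c \<in> corners B" "edge_of B c = e"
    using edge_of_image assms by (metis imageE)
  have "\<exists>i<len. edge_of B (walk i) = e"
    using c(1)
  proof (cases rule: corner_cases)
    case (1 i)
    then show ?thesis
      using c(2) by blast
  next
    case (2 i)
    then have "edge_of B (walk i) = e"
      using c(2) edge_of_seg[OF walk_in, of i] by (simp only:)
    then show ?thesis
      using 2(1) by blast
  qed
  then obtain i where i: "i < len" "edge_of B (walk i) = e"
    by blast
  have side_in: "side B (walk i) \<in> corners B" "side B (side B (walk i)) = walk i" "side B (walk i) \<noteq> walk i"
    using side_involution[OF walk_in] by blast+
  obtain j where j: "j < len" "side B (walk i) = walk j \<or> side B (walk i) = seg B (walk j)"
    using corner_cases[OF side_in(1)] by metis
  have edge_j: "edge_of B (walk j) = e"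
    using j(2) i(2) edge_of_side[OF walk_in, of i] edge_of_seg[OF walk_in, of j] by metis
  have neq: "i \<noteq> j"
    using j(2) side_in(3) rectangle[OF walk_in, of i] by blast
  have only: "k = i \<or> k = j" if k: "k < len" "edge_of B (walk k) = e" for k
  proof -
    have "walk k \<in> {d \<in> corners B. edge_of B d = edge_of B (walk i)}"
      using walk_in k(2) i(2) by simp
    then have "walk k \<in> {walk i, seg B (walk i), side B (walk i), seg B (side B (walk i))}"
      unfolding ribbon_corners[OF walk_in] .
    moreover have "seg B (side B (walk i)) = walk j" if "side B (walk i) \<noteq> walk j"
      using that j(2) seg_seg_walk by metis
    ultimately have "walk k = walk i \<or> walk k = walk j"
      using j(2) seg_walk_neq[symmetric] by (metis emptyE insertE)
    then show ?thesis
      using walk_eq_iff k(1) i(1) j(1) by blast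
  qed
  have swap: "side B (walk j) = seg B (walk i)" if "side B (walk i) = seg B (walk j)"
  proof -
    have "side B (seg B (walk j)) = walk i"
      using side_in(2) unfolding that .
    then have "seg B (side B (walk j)) = walk i"
      using rectangle[OF walk_in, of j] by simp
    moreover have "seg B (seg B (side B (walk j))) = side B (walk j)"
      using seg_involution side_involution[OF walk_in] by blast
    ultimately show ?thesis
      by simp
  qed
  have tw: "twisted e \<longleftrightarrow> side B (walk i) = walk j"
  proof
    assume "twisted e"
    then obtain k where k: "edge_of B (walk k) = e" "side B (walk k) \<in> range walk"
      by (auto simp: twisted_def)
    then have "k mod len = i \<or> k mod len = j"
      using only[of "k mod len"] walk_mod len_pos by simp
    then have "walk k = walk i \<or> walk k = walk j"
      using walk_mod by metis
    then have "side B (walk i) \<in> range walk \<or> side B (walk j) \<in> range walk"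
      using k(2) by metis
    then show "side B (walk i) = walk j"
      using j(2) swap seg_walk_neq by (metis imageE)
  next
    assume "side B (walk i) = walk j"
    then show "twisted e"
      using i(2) unfolding twisted_def by blast
  qed
  have positions: "{k. k < len \<and> edge_of B (walk k) = e} = {i, j}"
    using only i j(1) edge_j by blast
  show thesis
  proof (cases "i < j")
    case True
    then show ?thesis
      using that[of i j] i j edge_j positions tw by blast
  next
    case False
    have "side B (walk j) = walk i" if "side B (walk i) = walk j"
      using that side_in(2) by simp
    moreover have "{k. k < len \<and> edge_of B (walk k) = e} = {j, i}"
      using positions by blast
    ultimately show ?thesis
      using that[of j i] i j edge_j tw False neq swap by (metis linorder_neqE_nat)
  qed
qed

definition between :: "nat \<Rightarrow> nat \<Rightarrow> 'e list" where
  "between i j = map (\<lambda>k. edge_of B (walk k)) [Suc i..<j]"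

lemma word_split:
  assumes "i < j" "j < len"
  shows "word = map (\<lambda>k. edge_of B (walk k)) [0..<i] @ edge_of B (walk i) # between i j
    @ edge_of B (walk j) # map (\<lambda>k. edge_of B (walk k)) [Suc j..<len]"
proof -
  have "[0..<len] = [0..<i] @ i # [Suc i..<j] @ j # [Suc j..<len]"
    using assms upt_add_eq_append[of 0 i "len - i"] upt_add_eq_append[of "Suc i" j "len - j"]
      upt_conv_Cons[of i len] upt_conv_Cons[of j len] by simp
  then show ?thesis
    unfolding boundary_word_def between_def walk_def by simp
qed

lemma count_word:
  assumes "f \<in> edges B"
  shows "count_list word f = 2"
proof -
  obtain i j where ij: "i < j" "{k. k < len \<and> edge_of B (walk k) = f} = {i, j}"
    using obtain_positions[OF assms] by metis
  have "count_list word f = card {k. k < length word \<and> word ! k = f}"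
    by (simp add: count_list_eq_length_filter length_filter_conv_card eq_commute)
  also have "{k. k < length word \<and> word ! k = f} = {k. k < len \<and> edge_of B (walk k) = f}"
    using word_nth length_word by auto
  also have "card \<dots> = 2"
    using ij by simp
  finally show ?thesis .
qed

text \<open>
  A loop \<open>f\<close> is interlaced with \<open>e\<close> iff exactly one of its two ends lies between the ends of \<open>e\<close>.
  If neither or both do, \<open>f\<close> contributes an even number to every sum over the segments in between.
\<close>

lemma interlaced_iff_between:
  assumes ij: "i < j" "j < len" and e: "{k. k < len \<and> edge_of B (walk k) = e} = {i, j}"
    and f: "f \<in> edges B"
  shows "interlaced B e f \<longleftrightarrow> e \<noteq> f \<and> count_list (between i j) f = 1"
    "count_list (between i j) e = 0" "count_list (between i j) f \<le> 2"
proof -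
  have edge: "edge_of B (walk i) = e" "edge_of B (walk j) = e"
    using e ij by blast+
  have other: "edge_of B (walk k) \<noteq> e" if "k < len" "k \<noteq> i" "k \<noteq> j" for k
    using e that by blast
  let ?xs = "map (\<lambda>k. edge_of B (walk k)) [0..<i]"
  let ?zs = "map (\<lambda>k. edge_of B (walk k)) [Suc j..<len]"
  have avoid: "e \<notin> set (map (\<lambda>k. edge_of B (walk k)) ks)"
    if "\<And>k. k \<in> set ks \<Longrightarrow> k < len \<and> k \<noteq> i \<and> k \<noteq> j" for ks
  proof
    assume "e \<in> set (map (\<lambda>k. edge_of B (walk k)) ks)"
    then obtain k where "k \<in> set ks" "edge_of B (walk k) = e"
      by auto
    then show False
      using that[of k] other[of k] by blast
  qed
  have no_e: "e \<notin> set ?xs" "e \<notin> set (between i j)" "e \<notin> set ?zs"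
    unfolding between_def by (rule avoid, use ij in simp)+
  have word: "word = ?xs @ e # between i j @ e # ?zs"
    using word_split[OF ij] unfolding edge .
  show "count_list (between i j) e = 0"
    using no_e(2) by simp
  have two: "count_list (?xs @ e # between i j @ e # ?zs) f = 2"
    using count_word[OF f] unfolding word .
  then show "count_list (between i j) f \<le> 2"
    by (simp split: if_splits)
  show "interlaced B e f \<longleftrightarrow> e \<noteq> f \<and> count_list (between i j) f = 1"
  proof (cases "e = f")
    case False
    then show ?thesis
      unfolding interlaced_iff_alternating[of e f] word
      using alternating_iff_one_between[OF False no_e two] by (simp only: simp_thms)
  qed (simp add: interlaced_def)
qed

end

section \<open>Kernels and ranks over GF(2)\<close>

lemma (in vectorspace) card_carrier_eq_power_dim:
  assumes fin_dim
  shows "card (carrier V) = card (carrier K) ^ dim"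
proof -
  obtain b where b: "finite b" "basis b"
    using finite_basis_exists[OF assms] by blast
  then have b_V: "b \<subseteq> carrier V"
    by (simp add: basis_def)
  have unique: "\<exists>!a. a \<in> b \<rightarrow>\<^sub>E carrier K \<and> lincomb a b = v" if "v \<in> carrier V" for v
    using basis_criterion[OF b(1) b_V] b(2) that by blast
  have closed: "lincomb a b \<in> carrier V" if "a \<in> b \<rightarrow>\<^sub>E carrier K" for a
    using that b_V by (intro lincomb_closed) (auto simp: PiE_iff)
  have "bij_betw (\<lambda>a. lincomb a b) (b \<rightarrow>\<^sub>E carrier K) (carrier V)"
    unfolding bij_betw_def
  proof
    show "inj_on (\<lambda>a. lincomb a b) (b \<rightarrow>\<^sub>E carrier K)"
      using unique closed by (intro inj_onI) blast
    show "(\<lambda>a. lincomb a b) ` (b \<rightarrow>\<^sub>E carrier K) = carrier V"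
      using unique closed by blast
  qed
  then have "card (carrier V) = card (b \<rightarrow>\<^sub>E carrier K)"
    by (simp add: bij_betw_same_card)
  also have "\<dots> = card (carrier K) ^ card b"
    by (simp add: card_PiE[OF b(1)])
  finally show ?thesis
    using dim_basis[OF b] by simp
qed

lemma card_UNIV_bit: "card (UNIV :: bit set) = 2"
proof -
  have "(UNIV :: bit set) = {0, 1}"
    using bit.exhaust by blast
  moreover have "card {0, 1 :: bit} = 2"
    by simp
  ultimately show ?thesis
    by (simp only:)
qed

lemma card_carrier_vec_bit: "card (carrier_vec n :: bit vec set) = 2 ^ n"
proof -
  interpret vec_space "TYPE(bit)" n .
  show ?thesis
    using card_carrier_eq_power_dim[OF fin_dim] dim_is_n by (simp add: card_UNIV_bit)
qed

lemma card_mult_mat_vec_image_bit: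
  assumes A: "(A :: bit mat) \<in> carrier_mat n m"
  shows "card ((*\<^sub>v) A ` carrier_vec m) = 2 ^ vec_space.rank n A"
proof -
  interpret vec_space "TYPE(bit)" n .
  have cols: "set (cols A) \<subseteq> carrier_vec n"
    using cols_dim[of A] carrier_matD(1)[OF A] by simp
  have vs: "vectorspace class_ring (span_vs (set (cols A)))"
    using span_is_subspace[OF cols] subspace_is_vs by (simp add: subspace_def)
  have "card (carrier (span_vs (set (cols A)))) = card (UNIV :: bit set) ^ rank A"
    using vectorspace.card_carrier_eq_power_dim[OF vs fin_dim_span_cols[OF A]] unfolding rank_def by simp
  moreover have "span (set (cols A)) = (*\<^sub>v) A ` carrier_vec m"
    using col_space_eq[OF A] A unfolding col_space_def by auto
  ultimately show ?thesis
    by (simp add: card_UNIV_bit)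
qed

text \<open>
  Rank and nullity by counting: all fibres of the linear map are translates of the kernel.
\<close>

lemma card_kernel_bit:
  assumes A: "(A :: bit mat) \<in> carrier_mat n m"
  shows "card {v \<in> carrier_vec m. A *\<^sub>v v = 0\<^sub>v n} * 2 ^ vec_space.rank n A = 2 ^ m"
proof -
  let ?K = "{v \<in> carrier_vec m. A *\<^sub>v v = 0\<^sub>v n}" and ?I = "(*\<^sub>v) A ` carrier_vec m"
  define s where "s = inv_into (carrier_vec m) ((*\<^sub>v) A)"
  have s: "s y \<in> carrier_vec m" "A *\<^sub>v s y = y" if "y \<in> ?I" for y
    using that unfolding s_def by (auto intro: inv_into_into f_inv_into_f)
  have I_carrier: "y \<in> carrier_vec n" if "y \<in> ?I" for y
    using that A by auto
  have "bij_betw (\<lambda>(k, y). k + s y) (?K \<times> ?I) (carrier_vec m)"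
  proof (rule bij_betw_byWitness[where f' = "\<lambda>v. (v - s (A *\<^sub>v v), A *\<^sub>v v)"])
    show "\<forall>p\<in>?K \<times> ?I. (\<lambda>v. (v - s (A *\<^sub>v v), A *\<^sub>v v)) (case p of (k, y) \<Rightarrow> k + s y) = p"
    proof
      fix p assume "p \<in> ?K \<times> ?I"
      then obtain k y where p: "p = (k, y)" "k \<in> carrier_vec m" "A *\<^sub>v k = 0\<^sub>v n" "y \<in> ?I"
        by blast
      have "A *\<^sub>v (k + s y) = y"
        using mult_add_distrib_mat_vec[OF A p(2) s(1)[OF p(4)]] p(3) s(2)[OF p(4)] I_carrier[OF p(4)]
        by simp
      moreover have "k + s y - s y = k"
        using p(2) s(1)[OF p(4)] by (intro eq_vecI) auto
      ultimately show "(\<lambda>v. (v - s (A *\<^sub>v v), A *\<^sub>v v)) (case p of (k, y) \<Rightarrow> k + s y) = p"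
        using p(1) by simp
    qed
    have in_I: "A *\<^sub>v v \<in> ?I" if "v \<in> carrier_vec m" for v
      using that by blast
    show "\<forall>v\<in>carrier_vec m. (case (v - s (A *\<^sub>v v), A *\<^sub>v v) of (k, y) \<Rightarrow> k + s y) = v"
    proof
      fix v :: "bit vec" assume v: "v \<in> carrier_vec m"
      have "v - s (A *\<^sub>v v) + s (A *\<^sub>v v) = v"
        using v s(1)[OF in_I[OF v]] by (intro eq_vecI) auto
      then show "(case (v - s (A *\<^sub>v v), A *\<^sub>v v) of (k, y) \<Rightarrow> k + s y) = v"
        by simp
    qed
    show "(\<lambda>(k, y). k + s y) ` (?K \<times> ?I) \<subseteq> carrier_vec m"
      using s(1) by auto
    show "(\<lambda>v. (v - s (A *\<^sub>v v), A *\<^sub>v v)) ` carrier_vec m \<subseteq> ?K \<times> ?I"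
    proof (rule image_subsetI)
      fix v :: "bit vec" assume v: "v \<in> carrier_vec m"
      note sv = s[OF in_I[OF v]]
      have "A *\<^sub>v (v - s (A *\<^sub>v v)) = A *\<^sub>v v - A *\<^sub>v v"
        using mult_minus_distrib_mat_vec[OF A v sv(1)] sv(2) by simp
      also have "\<dots> = 0\<^sub>v n"
        using I_carrier[OF in_I[OF v]] by auto
      finally show "(v - s (A *\<^sub>v v), A *\<^sub>v v) \<in> ?K \<times> ?I"
        using v sv(1) in_I[OF v] by simp
    qed
  qed
  then have "card (?K \<times> ?I) = card (carrier_vec m :: bit vec set)"
    by (rule bij_betw_same_card)
  then show ?thesis
    using card_mult_mat_vec_image_bit[OF A] by (simp add: card_cartesian_product card_carrier_vec_bit)
qed

section \<open>Unions of faces as kernel vectors\<close>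

lemma bit_add_cancel: "(x :: bit) + (x + y) = y"
  by (cases x; cases y) simp_all

text \<open>
  Here \<open>t + h\<close> is the value at the entry of a loop's first end, \<open>x\<close> is the jump across the loop and
  \<open>s\<close> the sum of the jumps between its ends. The two equations compare the values along its two
  sides and turn out to be the same linear equation. The factor of \<open>x\<close> on the right is the diagonal
  entry of the loop.
\<close>

lemma bit_twisted_sides:
  fixes t h x s :: bit
  shows "t + (h + x + s) = t + h \<and> t + (h + x + s + x) = t + (h + x) \<longleftrightarrow> s + 1 * x = 0"
  by (cases t; cases h; cases x; cases s) simp_all

lemma bit_untwisted_sides:
  fixes t h x s :: bit
  shows "t + (h + x + s + x) = t + h \<and> t + (h + x + s) = t + (h + x) \<longleftrightarrow> s + 0 * x = 0"
  by (cases t; cases h; cases x; cases s) simp_all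

lemma sum_list_eq_sum_count:
  fixes X :: "'a \<Rightarrow> 'b :: comm_semiring_1"
  assumes "finite A" "set xs \<subseteq> A"
  shows "sum_list (map X xs) = (\<Sum>f\<in>A. of_nat (count_list xs f) * X f)"
  using assms(2)
proof (induction xs)
  case (Cons x xs)
  have "(\<Sum>f\<in>A. of_nat (count_list (x # xs) f) * X f) =
      (\<Sum>f\<in>A. (if x = f then X f else 0) + of_nat (count_list xs f) * X f)"
    by (intro sum.cong) (auto simp: algebra_simps)
  also have "\<dots> = X x + (\<Sum>f\<in>A. of_nat (count_list xs f) * X f)"
    using Cons.prems assms(1) by (simp add: sum.distrib)
  finally show ?case
    using Cons by simp
qed simp

context bouquet
begin

text \<open>
  A union of faces is thought of as a function on corners with values in GF(2) that is constant along
  arcs and sides. Going around the disc it only changes when a segment is crossed. If it jumps by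
  \<open>X e\<close> at both segments of each loop \<open>e\<close>, then after \<open>i\<close> segments it has changed by \<open>height X i\<close>.
\<close>

definition height :: "('e \<Rightarrow> bit) \<Rightarrow> nat \<Rightarrow> bit" where
  "height X i = (\<Sum>k<i. X (edge_of B (walk k)))"

lemma height_0: "height X 0 = 0"
  by (simp add: height_def)

lemma height_Suc: "height X (Suc i) = height X i + X (edge_of B (walk i))"
  by (simp add: height_def)

lemma height_between:
  assumes "i < j"
  shows "height X j = height X (Suc i) + sum_list (map X (between i j))"
proof -
  have "height X (Suc i + n) = height X (Suc i) + sum_list (map (\<lambda>k. X (edge_of B (walk k))) [Suc i..<Suc i + n])" for n
  proof (induction n)
    case (Suc n)
    have "[Suc i..<Suc i + Suc n] = [Suc i..<Suc i + n] @ [Suc i + n]"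
      by simp
    moreover have "height X (Suc i + Suc n) = height X (Suc i + n) + X (edge_of B (walk (Suc i + n)))"
      unfolding add_Suc_right by (rule height_Suc)
    ultimately show ?case
      unfolding Suc.IH by (simp only: map_append sum_list.append list.map sum_list.Cons sum_list.Nil add.assoc add_0_right)
  qed simp
  from this[of "j - Suc i"] show ?thesis
    using assms by (simp add: between_def comp_def)
qed

text \<open>
  Each loop is crossed twice per turn, so any choice of jumps gives a function on the circle.
\<close>

lemma height_len: "height X len = 0"
proof -
  have "height X len = sum_list (map X word)"
    by (simp add: height_def boundary_word_def walk_def comp_def sum_list_sum_nth atLeast0LessThan)
  also have "\<dots> = (\<Sum>f\<in>edges B. of_nat (count_list word f) * X f)"
  proof (rule sum_list_eq_sum_count[OF finite_edges])
    show "set word \<subseteq> edges B"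
      using walk_in edge_of_image unfolding boundary_word_def walk_def[symmetric] by auto
  qed
  also have "\<dots> = 0"
    using count_word by simp
  finally show ?thesis .
qed

lemma height_mod: "height X (i mod len) = height X i"
proof -
  have "height X (len + i) = height X i" for i
  proof (induction i)
    case (Suc i)
    then show ?case
      using walk_mod[of "len + i"] walk_mod[of i] by (simp add: height_Suc)
  qed (simp add: height_len height_0)
  then have "height X (i mod len + n * len) = height X (i mod len)" for n
    by (induction n) (simp_all add: add.left_commute)
  from this[of "i div len"] show ?thesis
    by (simp only: mod_mult_self1 mod_div_mult_eq)
qed

lemma height_cong: "walk i = walk j \<Longrightarrow> height X i = height X j"
  by (metis height_mod len_pos mod_less_divisor walk_eq_iff walk_mod)

text \<open>
  The row of the loop \<open>e\<close> in the matrix obtained from the adjacency matrix of the intersection graph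
  by putting a \<open>1\<close> on the diagonal at each twisted loop, applied to the vector \<open>X\<close>.
\<close>

definition row_form :: "('e \<Rightarrow> bit) \<Rightarrow> 'e \<Rightarrow> bit" where
  "row_form X e = (\<Sum>f\<in>edges B. of_bool (interlaced B e f) * X f) + of_bool (twisted e) * X e"

text \<open>
  The heart of the rank formula. A function with jumps \<open>X\<close> agrees along a side of \<open>e\<close> iff the jumps
  between the two corners of that side cancel. These come from the segments between the two ends of
  \<open>e\<close>, where a loop counts with odd multiplicity iff it is interlaced with \<open>e\<close>, and from the segment
  of \<open>e\<close> itself iff \<open>e\<close> is twisted.
\<close>

lemma sides_match_iff:
  assumes e: "e \<in> edges B"
    and walk_\<phi>: "\<And>i. \<phi> (walk i) = t + height X i"
    and seg_\<phi>: "\<And>i. \<phi> (seg B (walk i)) = t + height X (Suc i)"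
  shows "(\<forall>c\<in>corners B. edge_of B c = e \<longrightarrow> \<phi> (side B c) = \<phi> c) \<longleftrightarrow> row_form X e = 0"
proof -
  obtain i j where ij: "i < j" "j < len" and edge: "edge_of B (walk i) = e" "edge_of B (walk j) = e"
    and pos: "{k. k < len \<and> edge_of B (walk k) = e} = {i, j}"
    and tw: "twisted e \<Longrightarrow> side B (walk i) = walk j" "\<not> twisted e \<Longrightarrow> side B (walk i) = seg B (walk j)"
    using obtain_positions[OF e] by blast
  define s where "s = sum_list (map X (between i j))"
  have "set (between i j) \<subseteq> edges B"
    using walk_in edge_of_image unfolding between_def by auto
  then have "s = (\<Sum>f\<in>edges B. of_nat (count_list (between i j) f) * X f)"
    unfolding s_def by (rule sum_list_eq_sum_count[OF finite_edges])
  also have "\<dots> = (\<Sum>f\<in>edges B. of_bool (interlaced B e f) * X f)"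
  proof (rule sum.cong)
    fix f assume f: "f \<in> edges B"
    note between = interlaced_iff_between[OF ij pos f]
    have "(of_nat (count_list (between i j) f) :: bit) = of_bool (interlaced B e f)"
    proof (cases "e = f")
      case True
      then show ?thesis
        using between(1,2) by simp
    next
      case False
      have "count_list (between i j) f = 0 \<or> count_list (between i j) f = 1 \<or> count_list (between i j) f = 2"
        using between(3) by linarith
      then show ?thesis
        using between(1) False by (elim disjE) simp_all
    qed
    then show "of_nat (count_list (between i j) f) * X f = of_bool (interlaced B e f) * X f"
      by simp
  qed simp
  finally have row: "row_form X e = s + of_bool (twisted e) * X e"
    by (simp add: row_form_def)
  have heights: "height X (Suc i) = height X i + X e" "height X j = height X i + X e + s"
    "height X (Suc j) = height X i + X e + s + X e"
    using height_Suc[of X i] height_Suc[of X j] height_between[OF ij(1), of X] edge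
    by (simp_all add: s_def)
  have corners_e: "{c \<in> corners B. edge_of B c = e} = {walk i, seg B (walk i), side B (walk i), seg B (side B (walk i))}"
    using ribbon_corners[OF walk_in, of i] edge by simp
  have side_side: "side B (side B (walk i)) = walk i"
    "side B (seg B (walk i)) = seg B (side B (walk i))"
    "side B (seg B (side B (walk i))) = seg B (walk i)"
    using side_involution[OF walk_in] rectangle[OF walk_in]
      side_involution[OF seg_walk_in] by metis+
  have "(\<forall>c\<in>corners B. edge_of B c = e \<longrightarrow> \<phi> (side B c) = \<phi> c) \<longleftrightarrow>
      (\<forall>c\<in>{c \<in> corners B. edge_of B c = e}. \<phi> (side B c) = \<phi> c)"
    by blast
  also have "\<dots> \<longleftrightarrow> \<phi> (side B (walk i)) = \<phi> (walk i) \<and> \<phi> (seg B (side B (walk i))) = \<phi> (seg B (walk i))"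
    unfolding corners_e using side_side by auto
  also have "\<dots> \<longleftrightarrow> row_form X e = 0"
  proof (cases "twisted e")
    case True
    have "\<phi> (side B (walk i)) = t + (height X i + X e + s)"
      "\<phi> (seg B (side B (walk i))) = t + (height X i + X e + s + X e)"
      unfolding tw(1)[OF True] walk_\<phi> seg_\<phi> heights by (rule refl)+
    moreover have "of_bool (twisted e) = (1 :: bit)"
      using True by simp
    ultimately show ?thesis
      unfolding row walk_\<phi> seg_\<phi> heights(1) by (simp only: bit_twisted_sides)
  next
    case False
    have "\<phi> (side B (walk i)) = t + (height X i + X e + s + X e)"
      "\<phi> (seg B (side B (walk i))) = t + (height X i + X e + s)"
      unfolding tw(2)[OF False] seg_seg_walk walk_\<phi> seg_\<phi> heights by (rule refl)+
    moreover have "of_bool (twisted e) = (0 :: bit)"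
      using False by simp
    ultimately show ?thesis
      unfolding row walk_\<phi> seg_\<phi> heights(1) by (simp only: bit_untwisted_sides)
  qed
  finally show ?thesis .
qed

end

context bouquet
begin

text \<open>
  Any corner of the edge may serve as witness: if \<open>S\<close> is a union of faces, all four give the same
  truth value.
\<close>

definition jump :: "'c set \<Rightarrow> 'e \<Rightarrow> bit" where
  "jump S e = of_bool (\<exists>c\<in>corners B. edge_of B c = e \<and> (c \<in> S) \<noteq> (seg B c \<in> S))"

lemma jump_edge_of:
  assumes S: "S \<in> invariant_sets (corners B) (side B) (arc B)" and c: "c \<in> corners B"
  shows "jump S (edge_of B c) = of_bool (c \<in> S) + of_bool (seg B c \<in> S)"
proof -
  have side_iff: "side B d \<in> S \<longleftrightarrow> d \<in> S" if "d \<in> corners B" for d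
    using invariant_setsD(2)[OF S] side_involution[OF that] by metis
  have "(d \<in> S) \<noteq> (seg B d \<in> S) \<longleftrightarrow> (c \<in> S) \<noteq> (seg B c \<in> S)"
    if d: "d \<in> corners B" "edge_of B d = edge_of B c" for d
    using c d
  proof (cases rule: same_edge_cases)
    case 1
    then show ?thesis by simp
  next
    case 2
    have "seg B (seg B c) = c"
      using seg_involution[OF c] by blast
    then show ?thesis
      using 2 by auto
  next
    case 3
    have "seg B (side B c) = side B (seg B c)"
      using rectangle[OF c] by simp
    then show ?thesis
      using 3 side_iff[OF c] side_iff[of "seg B c"] seg_involution[OF c] by simp
  next
    case 4
    have "d = side B (seg B c)"
      using rectangle[OF c] 4 by simp
    moreover have "seg B d = side B c"
      using 4 seg_involution side_involution[OF c] by blast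
    ultimately show ?thesis
      using side_iff[OF c] side_iff[of "seg B c"] seg_involution[OF c] by auto
  qed
  then have "(\<exists>d\<in>corners B. edge_of B d = edge_of B c \<and> (d \<in> S) \<noteq> (seg B d \<in> S)) \<longleftrightarrow>
      (c \<in> S) \<noteq> (seg B c \<in> S)"
    using c by blast
  then show ?thesis
    unfolding jump_def by (cases "c \<in> S"; cases "seg B c \<in> S") simp_all
qed

lemma face_set_heights:
  assumes S: "S \<in> invariant_sets (corners B) (side B) (arc B)"
  shows "of_bool (walk i \<in> S) = of_bool (c0 \<in> S) + height (jump S) i"
    "of_bool (seg B (walk i) \<in> S) = of_bool (c0 \<in> S) + height (jump S) (Suc i)"
proof -
  have step: "(of_bool (seg B (walk i) \<in> S) :: bit) = of_bool (walk i \<in> S) + jump S (edge_of B (walk i))" for i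
    unfolding jump_edge_of[OF S walk_in] by (rule bit_add_cancel[symmetric])
  have "arc B x \<in> S \<longleftrightarrow> x \<in> S" if "x \<in> corners B" for x
    using invariant_setsD(3)[OF S] arc_involution[OF that] by metis
  then have next_eq: "walk (Suc i) \<in> S \<longleftrightarrow> seg B (walk i) \<in> S" for i
    unfolding walk_Suc using seg_walk_in by blast
  have main: "of_bool (walk i \<in> S) = of_bool (c0 \<in> S) + height (jump S) i" for i
  proof (induction i)
    case 0
    then show ?case
      by (simp add: walk_0 height_def)
  next
    case (Suc i)
    then show ?case
      by (simp only: next_eq step height_Suc add.assoc)
  qed
  then show "of_bool (walk i \<in> S) = of_bool (c0 \<in> S) + height (jump S) i" .
  show "of_bool (seg B (walk i) \<in> S) = of_bool (c0 \<in> S) + height (jump S) (Suc i)"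
    using main[of "Suc i"] unfolding next_eq .
qed

lemma row_form_jump:
  assumes S: "S \<in> invariant_sets (corners B) (side B) (arc B)" and "e \<in> edges B"
  shows "row_form (jump S) e = 0"
proof -
  have "side B c \<in> S \<longleftrightarrow> c \<in> S" if "c \<in> corners B" for c
    using invariant_setsD(2)[OF S] side_involution[OF that] by metis
  then show ?thesis
    using sides_match_iff[OF assms(2), of "\<lambda>c. of_bool (c \<in> S)", OF face_set_heights[OF S]] by simp
qed

lemma height_eqI:
  assumes "\<And>e. e \<in> edges B \<Longrightarrow> X e = Y e"
  shows "height X i = height Y i"
  unfolding height_def
proof (rule sum.cong[OF refl])
  fix k
  have "edge_of B (walk k) \<in> edges B"
    using walk_in[of k] edge_of_image by blast
  then show "X (edge_of B (walk k)) = Y (edge_of B (walk k))"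
    by (rule assms)
qed

lemma face_set_eqI:
  assumes S: "S \<in> invariant_sets (corners B) (side B) (arc B)"
    and S': "S' \<in> invariant_sets (corners B) (side B) (arc B)"
    and base: "c0 \<in> S \<longleftrightarrow> c0 \<in> S'" and jumps: "\<And>e. e \<in> edges B \<Longrightarrow> jump S e = jump S' e"
  shows "S = S'"
proof -
  have heights: "height (jump S) i = height (jump S') i" for i
    using jumps by (rule height_eqI)
  have eq: "(of_bool (c \<in> S) :: bit) = of_bool (c \<in> S')" if "c \<in> corners B" for c
    using that
  proof (cases rule: corner_cases)
    case (1 i)
    then show ?thesis
      by (simp only: face_set_heights(1)[OF S] face_set_heights(1)[OF S'] base heights)
  next
    case (2 i)
    then show ?thesis
      by (simp only: face_set_heights(2)[OF S] face_set_heights(2)[OF S'] base heights)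
  qed
  have same: "c \<in> S \<longleftrightarrow> c \<in> S'" if "c \<in> corners B" for c
    using eq[OF that] by (simp only: of_bool_eq_iff)
  then show ?thesis
    using invariant_setsD(1)[OF S] invariant_setsD(1)[OF S'] same by blast
qed

text \<open>
  The kernel equations say exactly that the function with jumps \<open>X\<close> can be continued over all
  ribbons.
\<close>

lemma face_set_exists:
  assumes X: "\<And>e. e \<in> edges B \<Longrightarrow> row_form X e = 0"
  obtains S where "S \<in> invariant_sets (corners B) (side B) (arc B)" "c0 \<in> S \<longleftrightarrow> b"
    "\<forall>e\<in>edges B. jump S e = X e"
proof -
  define t :: bit where "t = of_bool b"
  \<comment> \<open>Well defined although \<open>walk\<close> repeats itself, since heights are periodic along with it.\<close>
  define S where "S = {walk i | i. t + height X i = 1} \<union> {seg B (walk i) | i. t + height X (Suc i) = 1}"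
  have of_bool_1: "of_bool (y = 1) = y" for y :: bit
    by (cases y) simp_all
  have walk_S: "of_bool (walk i \<in> S) = t + height X i" for i
  proof -
    have "walk i \<in> S \<longleftrightarrow> (\<exists>j. walk i = walk j \<and> t + height X j = 1)"
      unfolding S_def using seg_walk_neq[symmetric] by blast
    also have "\<dots> \<longleftrightarrow> t + height X i = 1"
      using height_cong[of i _ X] by metis
    finally show ?thesis
      by (simp only: of_bool_1)
  qed
  have seg_S: "of_bool (seg B (walk i) \<in> S) = t + height X (Suc i)" for i
  proof -
    have "height X (Suc i) = height X (Suc j)" if "seg B (walk i) = seg B (walk j)" for j
    proof -
      have "walk i = walk j"
        using that seg_seg_walk by metis
      then show ?thesis
        unfolding height_Suc using height_cong[of i j X] by (simp only:)
    qed
    then have "(\<exists>j. seg B (walk i) = seg B (walk j) \<and> t + height X (Suc j) = 1) \<longleftrightarrow> t + height X (Suc i) = 1"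
      by metis
    moreover have "seg B (walk i) \<in> S \<longleftrightarrow> (\<exists>j. seg B (walk i) = seg B (walk j) \<and> t + height X (Suc j) = 1)"
      unfolding S_def using seg_walk_neq by blast
    ultimately show ?thesis
      by (simp only: of_bool_1)
  qed
  have S_corners: "S \<subseteq> corners B"
    unfolding S_def using walk_in seg_walk_in by blast
  have inv: "S \<in> invariant_sets (corners B) (side B) (arc B)"
  proof (rule invariant_setsI)
    fix x assume x: "x \<in> S"
    then have x_B: "x \<in> corners B"
      using S_corners by blast
    have "edge_of B x \<in> edges B"
      using x_B edge_of_image by blast
    then have "\<forall>c\<in>corners B. edge_of B c = edge_of B x \<longrightarrow>
        (of_bool (side B c \<in> S) :: bit) = of_bool (c \<in> S)"
      using sides_match_iff[of "edge_of B x" "\<lambda>c. of_bool (c \<in> S)" t X, OF _ walk_S seg_S] X by blast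
    then have "(of_bool (side B x \<in> S) :: bit) = of_bool (x \<in> S)"
      using x_B by blast
    then show "side B x \<in> S"
      using x by (simp only: of_bool_eq_iff)
    have "walk (Suc i) \<in> S \<longleftrightarrow> seg B (walk i) \<in> S" for i
      using walk_S[of "Suc i"] seg_S[of i] of_bool_eq_iff by metis
    then have arc_S: "arc B (walk (Suc i)) \<in> S \<longleftrightarrow> walk (Suc i) \<in> S"
      "arc B (seg B (walk i)) \<in> S \<longleftrightarrow> seg B (walk i) \<in> S" for i
      unfolding arc_walk_Suc walk_Suc[symmetric] by blast+
    have "arc B (walk i) \<in> S \<longleftrightarrow> walk i \<in> S" for i
    proof (cases i)
      case 0
      then have "walk i = walk (Suc (len - 1))"
        using walk_len walk_0 len_pos by simp
      then show ?thesis
        using arc_S(1) by metis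
    next
      case (Suc k)
      then show ?thesis
        using arc_S(1) by simp
    qed
    then show "arc B x \<in> S"
      using x arc_S(2) corner_cases[OF x_B] by metis
  qed (rule S_corners)
  have "c0 \<in> S \<longleftrightarrow> b"
  proof -
    have "(of_bool (c0 \<in> S) :: bit) = of_bool b"
      using walk_S[of 0] by (simp add: walk_0 height_def t_def)
    then show ?thesis
      by (simp only: of_bool_eq_iff)
  qed
  moreover have "jump S e = X e" if e: "e \<in> edges B" for e
  proof -
    obtain i where "edge_of B (walk i) = e"
      using obtain_positions[OF e] by metis
    then have "jump S e = t + height X i + (t + height X i + X e)"
      using jump_edge_of[OF inv walk_in, of i] walk_S[of i] seg_S[of i]
      by (simp only: height_Suc add.assoc)
    then show ?thesis
      by (simp only: bit_add_cancel)
  qed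
  ultimately show thesis
    using that inv by blast
qed

end

locale listed_bouquet = bouquet +
  fixes es :: "'b list"
  assumes distinct_es: "distinct es" and set_es: "set es = edges B"
begin

abbreviation "form \<equiv> adj_intersection B es + diag_indicator {e \<in> edges B. twisted e} es"

lemma form_carrier: "form \<in> carrier_mat (length es) (length es)"
  by (simp add: adj_intersection_def diag_indicator_def)

lemma index_exists: "e \<in> edges B \<Longrightarrow> \<exists>i<length es. es ! i = e"
  unfolding set_es[symmetric] in_set_conv_nth .

lemma form_mult_vec:
  assumes r: "r < length es"
  shows "(form *\<^sub>v vec (length es) (\<lambda>i. X (es ! i))) $ r = row_form X (es ! r)"
proof -
  let ?m = "length es" and ?e = "es ! r"
  have e: "?e \<in> edges B"
    using r set_es nth_mem by blast
  have entry: "form $$ (r, q) = of_bool (interlaced B ?e (es ! q)) + of_bool (r = q \<and> twisted ?e)"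
    if "q < ?m" for q
    using r that e by (auto simp: adj_intersection_def diag_indicator_def)
  have "(form *\<^sub>v vec ?m (\<lambda>i. X (es ! i))) $ r = (\<Sum>q<?m. form $$ (r, q) * X (es ! q))"
  proof -
    have "(form *\<^sub>v vec ?m (\<lambda>i. X (es ! i))) $ r = row form r \<bullet> vec ?m (\<lambda>i. X (es ! i))"
      using r carrier_matD(1)[OF form_carrier] by (intro index_mult_mat_vec) (simp only:)
    also have "\<dots> = (\<Sum>q<?m. row form r $ q * vec ?m (\<lambda>i. X (es ! i)) $ q)"
      by (simp only: scalar_prod_def dim_vec atLeast0LessThan)
    also have "\<dots> = (\<Sum>q<?m. form $$ (r, q) * X (es ! q))"
    proof (rule sum.cong[OF refl])
      fix q assume "q \<in> {..<?m}"
      then have "row form r $ q = form $$ (r, q)" "vec ?m (\<lambda>i. X (es ! i)) $ q = X (es ! q)"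
        using r carrier_matD[OF form_carrier] index_row(1)[of r form q] by simp_all
      then show "row form r $ q * vec ?m (\<lambda>i. X (es ! i)) $ q = form $$ (r, q) * X (es ! q)"
        by (simp only:)
    qed
    finally show ?thesis .
  qed
  also have "\<dots> = (\<Sum>q<?m. of_bool (interlaced B ?e (es ! q)) * X (es ! q) +
      of_bool (r = q \<and> twisted ?e) * X (es ! q))"
  proof (rule sum.cong[OF refl])
    fix q assume "q \<in> {..<?m}"
    then show "form $$ (r, q) * X (es ! q) = of_bool (interlaced B ?e (es ! q)) * X (es ! q) +
      of_bool (r = q \<and> twisted ?e) * X (es ! q)"
      using entry[of q] by (simp only: lessThan_iff distrib_right)
  qed
  also have "\<dots> = (\<Sum>q<?m. of_bool (interlaced B ?e (es ! q)) * X (es ! q)) +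
      (\<Sum>q<?m. of_bool (r = q \<and> twisted ?e) * X (es ! q))"
    by (rule sum.distrib)
  also have "(\<Sum>q<?m. of_bool (r = q \<and> twisted ?e) * X (es ! q)) =
      (\<Sum>q<?m. if r = q then of_bool (twisted ?e) * X (es ! q) else 0)"
    by (intro sum.cong refl) (simp only: of_bool_def split: if_split, simp)
  also have "\<dots> = of_bool (twisted ?e) * X ?e"
    using r by (simp only: sum.delta' finite_lessThan lessThan_iff if_True)
  also have "(\<Sum>q<?m. of_bool (interlaced B ?e (es ! q)) * X (es ! q)) =
      (\<Sum>f\<in>edges B. of_bool (interlaced B ?e f) * X f)"
    by (rule sum.reindex_bij_betw) (use bij_betw_nth[OF distinct_es] set_es in blast)
  finally show ?thesis
    unfolding row_form_def .
qed

text \<open>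
  A union of faces is coded by its value at the base corner and its jumps.
\<close>

definition face_code :: "'c set \<Rightarrow> bool \<times> bit vec" where
  "face_code S = (c0 \<in> S, vec (length es) (\<lambda>i. jump S (es ! i)))"

abbreviation "null_space \<equiv> {v \<in> carrier_vec (length es). form *\<^sub>v v = 0\<^sub>v (length es)}"

lemma bij_betw_face_code:
  "bij_betw face_code (invariant_sets (corners B) (side B) (arc B)) (UNIV \<times> null_space)"
  unfolding bij_betw_def
proof
  show "inj_on face_code (invariant_sets (corners B) (side B) (arc B))"
  proof (rule inj_onI)
    fix S S' assume S: "S \<in> invariant_sets (corners B) (side B) (arc B)"
      "S' \<in> invariant_sets (corners B) (side B) (arc B)" and eq: "face_code S = face_code S'"
    have "jump S e = jump S' e" if e: "e \<in> edges B" for e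
    proof -
      obtain i where i: "i < length es" "es ! i = e"
        using index_exists[OF e] by blast
      have "snd (face_code S) $ i = snd (face_code S') $ i"
        unfolding eq by (rule refl)
      then show ?thesis
        unfolding face_code_def snd_conv index_vec[OF i(1)] i(2) .
    qed
    moreover have "c0 \<in> S \<longleftrightarrow> c0 \<in> S'"
      using eq by (simp add: face_code_def)
    ultimately show "S = S'"
      using S face_set_eqI by blast
  qed
  show "face_code ` invariant_sets (corners B) (side B) (arc B) = UNIV \<times> null_space"
  proof
    show "face_code ` invariant_sets (corners B) (side B) (arc B) \<subseteq> UNIV \<times> null_space"
    proof (rule image_subsetI)
      fix S assume S: "S \<in> invariant_sets (corners B) (side B) (arc B)"
      have "form *\<^sub>v vec (length es) (\<lambda>i. jump S (es ! i)) = 0\<^sub>v (length es)"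
      proof (rule eq_vecI)
        fix r assume "r < dim_vec (0\<^sub>v (length es) :: bit vec)"
        then have r: "r < length es"
          by simp
        then have "es ! r \<in> edges B"
          using set_es nth_mem by blast
        then show "(form *\<^sub>v vec (length es) (\<lambda>i. jump S (es ! i))) $ r = 0\<^sub>v (length es) $ r"
          using form_mult_vec[OF r] row_form_jump[OF S] r by simp
      qed (simp add: diag_indicator_def)
      then show "face_code S \<in> UNIV \<times> null_space"
        by (simp add: face_code_def)
    qed
    show "UNIV \<times> null_space \<subseteq> face_code ` invariant_sets (corners B) (side B) (arc B)"
    proof
      fix p :: "bool \<times> bit vec" assume "p \<in> UNIV \<times> null_space"
      then have snd_p: "snd p \<in> null_space"
        by (rule mem_Times_iff[THEN iffD1, THEN conjunct2])
      define b v where "b = fst p" and "v = snd p"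
      then have p: "p = (b, v)" "v \<in> carrier_vec (length es)" "form *\<^sub>v v = 0\<^sub>v (length es)"
        using snd_p by (simp_all only: mem_Collect_eq prod.collapse)
      define X where "X e = v $ inv_into {..<length es} ((!) es) e" for e
      have X_nth: "X (es ! i) = v $ i" if "i < length es" for i
      proof -
        have "inj_on ((!) es) {..<length es}"
          using bij_betw_nth[OF distinct_es] by (simp add: bij_betw_def)
        then show ?thesis
          using that by (simp add: X_def inv_into_f_f)
      qed
      have v: "v = vec (length es) (\<lambda>i. X (es ! i))"
        using p(2) X_nth by (intro eq_vecI) auto
      have zero: "row_form X e = 0" if "e \<in> edges B" for e
      proof -
        obtain r where r: "r < length es" "es ! r = e"
          using index_exists[OF \<open>e \<in> edges B\<close>] by blast
        have "row_form X e = (form *\<^sub>v v) $ r"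
          using form_mult_vec[OF r(1), of X] unfolding v[symmetric] r(2) by (rule sym)
        then show ?thesis
          using p(3) r(1) by simp
      qed
      obtain S where S: "S \<in> invariant_sets (corners B) (side B) (arc B)" "c0 \<in> S \<longleftrightarrow> b"
        and jump: "\<forall>e\<in>edges B. jump S e = X e"
        using zero by (rule face_set_exists[where b = b])
      have "vec (length es) (\<lambda>i. jump S (es ! i)) = v"
      proof (subst v, rule eq_vecI)
        fix i assume "i < dim_vec (vec (length es) (\<lambda>i. X (es ! i)))"
        then have i: "i < length es"
          by simp
        then have "es ! i \<in> edges B"
          using set_es nth_mem by blast
        then show "vec (length es) (\<lambda>i. jump S (es ! i)) $ i = vec (length es) (\<lambda>i. X (es ! i)) $ i"
          using jump i by simp
      qed simp
      then have "face_code S = p"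
        using p(1) S(2) by (simp add: face_code_def)
      then show "p \<in> face_code ` invariant_sets (corners B) (side B) (arc B)"
        using S(1) by blast
    qed
  qed
qed

text \<open>
  With \<open>m\<close> loops, \<open>F\<close> faces and rank \<open>r\<close>, counting unions of faces in two ways gives
  \<open>2 ^ F = 2 * 2 ^ (m - r)\<close>. The Euler genus \<open>2 - (1 - m + F)\<close> is therefore \<open>r\<close>.
\<close>

lemma euler_genus_eq_rank: "euler_genus B = int (vec_space.rank (length es) form)"
proof -
  let ?m = "length es" and ?Q = "corners B // orbit_rel (corners B) (side B) (arc B)"
  let ?r = "vec_space.rank ?m form"
  have "2 ^ card ?Q = 2 * card null_space"
    using involution_pair.card_invariant_sets[OF face_pair] bij_betw_same_card[OF bij_betw_face_code]
    by (simp add: card_cartesian_product)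
  then have "2 ^ card ?Q * 2 ^ ?r = 2 * (2 ^ ?m :: nat)"
    using card_kernel_bit[OF form_carrier] by simp
  then have "(2 :: nat) ^ (card ?Q + ?r) = 2 ^ Suc ?m"
    by (simp add: power_add)
  then have sum: "card ?Q + ?r = Suc ?m"
    by (rule power_inject_exp[THEN iffD1, rotated]) simp
  obtain w where w: "verts B = {w}"
    using one_vertex by (auto simp: card_1_singleton_iff)
  then have "vert_of B c0 = w"
    using vert_of_in[OF base_in] by simp
  then have "w \<in> vert_of B ` corners B"
    using base_in by (metis imageI)
  then have "faces B = {} <+> ?Q"
    using w by (simp add: faces_def)
  moreover have "finite ?Q"
    using finite_quotient[OF finite_corners] involution_pair.equiv_orbit_rel[OF face_pair]
    by (metis equivE)
  ultimately have "card (faces B) = card ?Q"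
    by (simp add: card_Plus)
  moreover have "card (edges B) = ?m"
    using distinct_card[OF distinct_es] set_es by simp
  moreover have "card (comps B (edges B)) = 1"
    unfolding card_comps_eq_1_iff using w by auto
  ultimately show ?thesis
    using sum one_vertex unfolding euler_genus_def euler_char_def by linarith
qed

end

lemma euler_genus_bouquet_without_edges:
  assumes "ribbon_graph B" "card (verts B) = 1" "corners B = {}"
  shows "euler_genus B = 0"
proof -
  interpret ribbon_graph B by fact
  obtain w where w: "verts B = {w}"
    using assms(2) by (auto simp: card_1_singleton_iff)
  have "faces B = {w} <+> {}"
    using w assms(3) by (simp add: faces_def quotient_def)
  moreover have "edges B = {}"
    using edge_of_image assms(3) by simp
  moreover have "card (comps B (edges B)) = 1"
    unfolding card_comps_eq_1_iff using w by auto
  ultimately show ?thesis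
    using w by (simp add: euler_genus_def euler_char_def card_Plus)
qed

lemma boundary_word_twist: "boundary_word (twist B Y) c = boundary_word B c"
  by (simp only: boundary_word_def twist_simps)

lemma interlaced_twist [simp]: "interlaced (twist B Y) e f = interlaced B e f"
  by (simp only: interlaced_def boundary_word_twist twist_simps)

context bouquet
begin

lemma bouquet_twist: "bouquet (twist B Y) c0"
  using ribbon_graph_twist[of Y] one_vertex base_in by (simp add: bouquet_def bouquet_axioms_def)

lemma walk_twist: "bouquet.walk (twist B Y) c0 = walk"
  unfolding bouquet.walk_def[OF bouquet_twist, abs_def] walk_def[abs_def] twist_simps by (rule refl)

lemma twisted_twist:
  assumes e: "e \<in> edges B"
  shows "bouquet.twisted (twist B Y) c0 e \<longleftrightarrow> twisted e \<noteq> (e \<in> Y)"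
proof (cases "e \<in> Y")
  case False
  then show ?thesis
    unfolding bouquet.twisted_def[OF bouquet_twist] walk_twist twisted_def by auto
next
  case True
  obtain i j where ij: "i < j" "j < len" "edge_of B (walk i) = e" "edge_of B (walk j) = e"
    "{k. k < len \<and> edge_of B (walk k) = e} = {i, j}"
    "twisted e \<Longrightarrow> side B (walk i) = walk j" "\<not> twisted e \<Longrightarrow> side B (walk i) = seg B (walk j)"
    using obtain_positions[OF e] by blast
  interpret T: bouquet "twist B Y" c0
    by (rule bouquet_twist)
  obtain k l where kl: "k < l" "l < len" "edge_of B (walk k) = e" "edge_of B (walk l) = e"
    "{m. m < len \<and> edge_of B (walk m) = e} = {k, l}"
    "T.twisted e \<Longrightarrow> side (twist B Y) (walk k) = walk l"
    "\<not> T.twisted e \<Longrightarrow> side (twist B Y) (walk k) = seg B (walk l)"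
    using T.obtain_positions[of e, unfolded walk_twist twist_simps(1-7), OF e] by blast
  have "{i, j} = {k, l}"
    using ij(5) kl(5) by simp
  then have "k = i" "l = j"
    using ij(1) kl(1) by (auto simp: doubleton_eq_iff)
  moreover have "side (twist B Y) (walk i) = seg B (side B (walk i))"
    using ij(3) True rectangle[OF walk_in, of i] by simp
  ultimately show ?thesis
    using True kl(6,7) ij(6,7) seg_seg_walk seg_walk_neq by metis
qed

end

lemma diag_indicator_cong:
  assumes "\<And>e. e \<in> set es \<Longrightarrow> e \<in> Y \<longleftrightarrow> e \<in> Z"
  shows "diag_indicator Y es = diag_indicator Z es"
  unfolding diag_indicator_def
proof (rule cong_mat[OF refl refl])
  fix i j assume "i < length es"
  then have "es ! i \<in> Y \<longleftrightarrow> es ! i \<in> Z"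
    by (intro assms nth_mem)
  then show "(case (i, j) of (i, j) \<Rightarrow> if i = j \<and> es ! i \<in> Y then 1 else 0) =
      (case (i, j) of (i, j) \<Rightarrow> if i = j \<and> es ! i \<in> Z then 1 else 0)"
    by (simp only: prod.case)
qed

lemma adj_intersection_twist [simp]: "adj_intersection (twist B Y) es = adj_intersection B es"
  by (simp only: adj_intersection_def interlaced_twist)

section \<open>Partial Petrials\<close>

text \<open>
  Twisting changes which loops are twisted but not how their ends are placed on the disc. Hence all
  partial Petrials share one adjacency matrix, and the diagonal is the symmetric difference of the
  set of twisted loops \<open>W\<close> and the set \<open>Y\<close> of loops that are twisted in addition. A bouquet without
  loops is treated separately because it has no base corner.
\<close>

lemma euler_genus_twist_bouquet:
  assumes B: "ribbon_graph B" "card (verts B) = 1" and es: "distinct es" "set es = edges B"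
  obtains W where "W \<subseteq> edges B" "\<forall>Y\<in>Pow (edges B). euler_genus (twist B Y) =
    int (vec_space.rank (length es) (adj_intersection B es + diag_indicator (sym_diff W Y) es))"
proof (cases "corners B = {}")
  case True
  then have "edges B = {}"
    using ribbon_graph.edge_of_image[OF B(1)] by simp
  then have es_Nil: "es = []"
    using es(2) by simp
  have rank: "vec_space.rank (length es) (adj_intersection B es + diag_indicator Z es) = 0" for Z
    using vec_space.rank_le_nc[of "adj_intersection B es + diag_indicator Z es" "length es" "length es"]
      es_Nil by (simp add: adj_intersection_def diag_indicator_def)
  have genus: "euler_genus (twist B Y) = 0" for Y
    using euler_genus_bouquet_without_edges[of "twist B Y"] ribbon_graph.ribbon_graph_twist[OF B(1)] B(2) True
    by simp
  show thesis
  proof (rule that; (rule ballI)?)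
    show "{} \<subseteq> edges B"
      by simp
    show "euler_genus (twist B Y) = int (vec_space.rank (length es)
        (adj_intersection B es + diag_indicator (sym_diff {} Y) es))" for Y
      unfolding genus rank by simp
  qed
next
  case False
  then obtain c0 where "c0 \<in> corners B"
    by blast
  then interpret bouquet B c0
    using B by (simp add: bouquet_def bouquet_axioms_def)
  show thesis
  proof (rule that; (rule ballI)?)
    show "{e \<in> edges B. twisted e} \<subseteq> edges B"
      by blast
    fix Y
    have T: "listed_bouquet (twist B Y) c0 es"
      using bouquet_twist es by (simp add: listed_bouquet_def listed_bouquet_axioms_def)
    have "diag_indicator {e \<in> edges B. bouquet.twisted (twist B Y) c0 e} es =
        diag_indicator (sym_diff {e \<in> edges B. twisted e} Y) es"
      by (rule diag_indicator_cong) (use twisted_twist es(2) in auto)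
    then show "euler_genus (twist B Y) = int (vec_space.rank (length es)
        (adj_intersection B es + diag_indicator (sym_diff {e \<in> edges B. twisted e} Y) es))"
      using listed_bouquet.euler_genus_eq_rank[OF T] by simp
  qed
qed

text \<open>
  As \<open>Y\<close> runs through all sets of loops, so does its symmetric difference with \<open>W\<close>. This is why the
  diagonal of the original bouquet disappears from the formula.
\<close>

lemma partial_petrial_poly_bouquet:
  assumes B: "ribbon_graph B" "card (verts B) = 1" and es: "distinct es" "set es = edges B"
  shows "partial_petrial_poly B = (\<Sum>Y\<in>Pow (edges B).
    monom 1 (vec_space.rank (length es) (adj_intersection B es + diag_indicator Y es)))"
proof -
  obtain W where W: "W \<subseteq> edges B" and genus: "\<forall>Y\<in>Pow (edges B). euler_genus (twist B Y) =
    int (vec_space.rank (length es) (adj_intersection B es + diag_indicator (sym_diff W Y) es))"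
    using assms by (rule euler_genus_twist_bouquet)
  have "bij_betw (sym_diff W) (Pow (edges B)) (Pow (edges B))"
    by (rule bij_betw_byWitness[where f' = "sym_diff W"]) (use W in auto)
  then have "(\<Sum>Y\<in>Pow (edges B). monom (1::int) (vec_space.rank (length es)
        (adj_intersection B es + diag_indicator (sym_diff W Y) es))) =
      (\<Sum>Y\<in>Pow (edges B). monom 1 (vec_space.rank (length es) (adj_intersection B es + diag_indicator Y es)))"
    by (rule sum.reindex_bij_betw)
  moreover have "partial_petrial_poly B = (\<Sum>Y\<in>Pow (edges B). monom 1 (vec_space.rank (length es)
        (adj_intersection B es + diag_indicator (sym_diff W Y) es)))"
    unfolding partial_petrial_poly_def by (rule sum.cong[OF refl]) (simp only: genus[rule_format] nat_int)
  ultimately show ?thesis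
    by simp
qed

lemma sum_Pow_union_disjoint:
  assumes "A \<inter> B = {}"
  shows "(\<Sum>Z\<in>Pow (A \<union> B). h Z) = (\<Sum>X\<in>Pow A. \<Sum>Y\<in>Pow B. h (X \<union> Y))"
proof -
  have "bij_betw (\<lambda>(X, Y). X \<union> Y) (Pow A \<times> Pow B) (Pow (A \<union> B))"
    by (rule bij_betw_byWitness[where f' = "\<lambda>Z. (Z \<inter> A, Z \<inter> B)"]) (use assms in auto)
  then have "(\<Sum>Z\<in>Pow (A \<union> B). h Z) = (\<Sum>(X, Y)\<in>Pow A \<times> Pow B. h (X \<union> Y))"
    by (simp add: sum.reindex_bij_betw[symmetric] case_prod_unfold)
  then show ?thesis
    by (simp add: sum.cartesian_product)
qed

theorem theorem1p2:
  fixes G :: "('v, 'e, 'c) ribbon" and T :: "'e set" and es :: "'e list"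
  assumes "ribbon_graph G"
    and "ribbon_connected G"
    and "card (verts G) \<ge> 2"
    and "spanning_tree G T"
    and "distinct es" and "set es = edges G - T"
  shows "partial_petrial_poly G = (\<Sum>X\<in>Pow T. partial_petrial_poly (Aux (twist G X) T)) \<and>
    (\<Sum>X\<in>Pow T. partial_petrial_poly (Aux (twist G X) T)) =
      (\<Sum>X\<in>Pow T. \<Sum>Y\<in>Pow (edges G - T).
         monom 1 (vec_space.rank (length es)
           (adj_intersection (Aux (twist G X) T) es + diag_indicator Y es)))"
proof
  interpret ribbon_graph G
    by fact
  have tree: "tree_of_bridges G T"
    using assms(4) by (rule spanning_tree_imp_tree_of_bridges)
  then have T_E: "T \<subseteq> edges G"
    by (simp add: tree_of_bridges_def)
  then have fin_T: "finite T"
    using finite_edges by (rule finite_subset)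
  have tree_twist: "tree_of_bridges (twist G X) T" for X
    using tree by simp
  note Aux = Aux_properties[OF ribbon_graph_twist tree_twist fin_T]
  have genus: "euler_genus (twist (Aux (twist G X) T) Y) = euler_genus (twist G (X \<union> Y))"
    if "X \<subseteq> T" "Y \<subseteq> edges G - T" for X Y
  proof -
    have "ribbon_graph (twist (twist G X) Y)"
      using ribbon_graph_twist by (rule ribbon_graph.ribbon_graph_twist)
    moreover have "tree_of_bridges (twist (twist G X) Y) T"
      using tree by simp
    ultimately have "euler_genus (Aux (twist (twist G X) Y) T) = euler_genus (twist (twist G X) Y)"
      using fin_T by (rule Aux_properties(4))
    moreover have "twist (Aux (twist G X) T) Y = Aux (twist (twist G X) Y) T"
      using that(2) by (intro twist_Aux[OF fin_T]) blast
    moreover have "euler_genus (twist (twist G X) Y) = euler_genus (twist G (X \<union> Y))"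
      using that by (intro euler_genus_twist_twist) blast
    ultimately show ?thesis
      by simp
  qed
  have "partial_petrial_poly G = (\<Sum>A\<in>Pow (T \<union> (edges G - T)). monom 1 (nat (euler_genus (twist G A))))"
    using T_E by (simp add: partial_petrial_poly_def Un_absorb1)
  also have "\<dots> = (\<Sum>X\<in>Pow T. \<Sum>Y\<in>Pow (edges G - T). monom 1 (nat (euler_genus (twist G (X \<union> Y)))))"
    by (rule sum_Pow_union_disjoint) blast
  also have "\<dots> = (\<Sum>X\<in>Pow T. partial_petrial_poly (Aux (twist G X) T))"
    unfolding partial_petrial_poly_def Aux(3) twist_simps
    using genus by (intro sum.cong) simp_all
  finally show "partial_petrial_poly G = (\<Sum>X\<in>Pow T. partial_petrial_poly (Aux (twist G X) T))" .
  show "(\<Sum>X\<in>Pow T. partial_petrial_poly (Aux (twist G X) T)) =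
      (\<Sum>X\<in>Pow T. \<Sum>Y\<in>Pow (edges G - T).
         monom 1 (vec_space.rank (length es)
           (adj_intersection (Aux (twist G X) T) es + diag_indicator Y es)))"
  proof (rule sum.cong)
    fix X
    have "set es = edges (Aux (twist G X) T)"
      using assms(6) Aux(3) by simp
    then show "partial_petrial_poly (Aux (twist G X) T) = (\<Sum>Y\<in>Pow (edges G - T).
         monom 1 (vec_space.rank (length es)
           (adj_intersection (Aux (twist G X) T) es + diag_indicator Y es)))"
      using partial_petrial_poly_bouquet[OF Aux(1,2) assms(5)] Aux(3) by simp
  qed simp
qed

end
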